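(* Let $p>1$ and let $V\subseteq X$ be nonempty and connected. Let $h$ be non-negative on $C_c(V)$. Then $h$ is subcritical in $V$ if and only if for every $o\in V$ there exists a normalised Green's function $G_o$ in $V$ at $o$.
   Context: $X$ is a countably infinite set, $m\colon X\to(0,\infty)$, and $b\colon X\times X\to[0,\infty)$ is symmetric with zero diagonal and $\sum_{y\in X}b(x,y)<\infty$ for every $x\in X$. Write $x\sim y$ if $b(x,y)>0$. A set $V\subseteq X$ is connected if any two of its points are joined by a path $x_0\sim x_1\sim\dots\sim x_n$ inside $V$. The graph is assumed connected, i.e. $X$ is connected. $\partial V=\{y\in X\setminus V: y\sim z \text{ for some } z\in V\}$. $c\colon X\to\mathbb R$ is an arbitrary function. $C(X)$ is the set of real functions on $X$; $C_c(V)$ is the set of functions on $X$ with finite support contained in $V$. For $a\in\mathbb R$ put $a^{\langle p-1\rangle}=|a|^{p-1}\operatorname{sgn}(a)$. For $V\subseteq X$, $F(V)=\{f\in C(X):\sum_{y\in X}b(x,y)|f(y)|^{p-1}<\infty\ \forall x\in V\}$, and for $f\in F(V)$, $x\in V$, $$Hf(x)=\frac1{m(x)}\sum_{y\in X}b(x,y)\,(f(x)-f(y))^{\langle p-1\rangle}+\frac{c(x)}{m(x)}f(x)^{\langle p-1\rangle}.$$ A function $u\in F(V)$ is harmonic (superharmonic) on $V$ if $Hu=0$ ($Hu\ge0$) on $V$. "Positive" means $\ge 0$ and not identically $0$. The energy functional is $h(\varphi)=\frac12\sum_{x,y\in X}b(x,y)|\varphi(x)-\varphi(y)|^p+\sum_{x\in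 X}c(x)|\varphi(x)|^p$ for $\varphi\in C_c(X)$. If $h\ge0$ on $C_c(V)$, then $h$ is called subcritical in $V$ if there is a function $w\colon V\to[0,\infty)$, not identically zero, such that $h(\varphi)\ge\sum_{x\in V}|\varphi(x)|^pw(x)$ for all $\varphi\in C_c(V)$; otherwise it is critical in $V$. Minimal growth: let $V\subseteq X$ be connected and $K\subseteq V$ finite. $\mathcal M(V\setminus K)$ is the set of functions $u\in F(V\setminus K)$ that are harmonic on $V\setminus K$, positive on $V\cup\partial V$, and such that for every finite connected $\tilde K\subseteq V$ with $K\subseteq\tilde K$ and every positive function $v\in F(V\setminus\tilde K)$ that is superharmonic in $V\setminus\tilde K$: if $u\le v$ on $\tilde K$, then $u\le v$ on $V\setminus\tilde K$. A normalised Green's function in $V$ at $o\in V$ is a function $u\in\mathcal M(V\setminus\{o\})\cap F(V)$ with $Hu=1_o$ on $V$, where $1_o$ is the indicator function of $\{o\}$. *)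

theory Defs
  imports "HOL-Analysis.Analysis"
begin

text \<open>
  The vertex set \<open>X\<close> is the (countably infinite) universe of the type variable \<open>'a\<close>, so that
  real functions on \<open>X\<close> are the functions of type \<open>'a \<Rightarrow> real\<close>. All possibly infinite sums are
  unordered sums (\<open>summable_on\<close>, \<open>infsum\<close>).
\<close>

definition adjacent :: "('a \<Rightarrow> 'a \<Rightarrow> real) \<Rightarrow> 'a \<Rightarrow> 'a \<Rightarrow> bool" where
  "adjacent b x y \<longleftrightarrow> b x y > 0"

text \<open>Paths are not allowed to leave \<open>V\<close>; the empty set counts as connected.\<close>

definition graph_connected :: "('a \<Rightarrow> 'a \<Rightarrow> real) \<Rightarrow> 'a set \<Rightarrow> bool" where
  "graph_connected b V \<longleftrightarrow>
     (\<forall>x\<in>V. \<forall>y\<in>V. (x, y) \<in> {(s, t). s \<in> V \<and> t \<in> V \<and> adjacent b s t}\<^sup>*)"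

definition vertex_boundary :: "('a \<Rightarrow> 'a \<Rightarrow> real) \<Rightarrow> 'a set \<Rightarrow> 'a set" where
  "vertex_boundary b V = {y. y \<notin> V \<and> (\<exists>z\<in>V. adjacent b y z)}"

locale connected_weighted_graph =
  fixes m :: "'a \<Rightarrow> real" and b :: "'a \<Rightarrow> 'a \<Rightarrow> real"
  assumes countable_vertices: "countable (UNIV :: 'a set)"
    and infinite_vertices: "infinite (UNIV :: 'a set)"
    and m_pos: "\<And>x. m x > 0"
    and b_nonneg: "\<And>x y. b x y \<ge> 0"
    and b_sym: "\<And>x y. b x y = b y x"
    and b_diag: "\<And>x. b x x = 0"
    and b_summable: "\<And>x. (\<lambda>y. b x y) summable_on UNIV"
    and connected_UNIV: "graph_connected b UNIV"

definition Cc :: "'a set \<Rightarrow> ('a \<Rightarrow> real) set" where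
  "Cc V = {f. finite {x. f x \<noteq> 0} \<and> {x. f x \<noteq> 0} \<subseteq> V}"

definition signed_powr :: "real \<Rightarrow> real \<Rightarrow> real" where
  "signed_powr a q = \<bar>a\<bar> powr q * sgn a"

definition F_space :: "('a \<Rightarrow> 'a \<Rightarrow> real) \<Rightarrow> real \<Rightarrow> 'a set \<Rightarrow> ('a \<Rightarrow> real) set" where
  "F_space b p V = {f. \<forall>x\<in>V. (\<lambda>y. b x y * \<bar>f y\<bar> powr (p - 1)) summable_on UNIV}"

text \<open>Only meaningful for \<open>f \<in> F_space b p V\<close> and \<open>x \<in> V\<close>, where the sum converges absolutely.\<close>

definition H_op ::
  "('a \<Rightarrow> real) \<Rightarrow> ('a \<Rightarrow> 'a \<Rightarrow> real) \<Rightarrow> ('a \<Rightarrow> real) \<Rightarrow> real \<Rightarrow> ('a \<Rightarrow> real) \<Rightarrow> 'a \<Rightarrow> real" where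
  "H_op m b c p f x =
     1 / m x * (\<Sum>\<^sub>\<infinity>y. b x y * signed_powr (f x - f y) (p - 1))
     + c x / m x * signed_powr (f x) (p - 1)"

definition harmonic_on ::
  "('a \<Rightarrow> real) \<Rightarrow> ('a \<Rightarrow> 'a \<Rightarrow> real) \<Rightarrow> ('a \<Rightarrow> real) \<Rightarrow> real \<Rightarrow> 'a set \<Rightarrow> ('a \<Rightarrow> real) \<Rightarrow> bool" where
  "harmonic_on m b c p V u \<longleftrightarrow> u \<in> F_space b p V \<and> (\<forall>x\<in>V. H_op m b c p u x = 0)"

definition superharmonic_on ::
  "('a \<Rightarrow> real) \<Rightarrow> ('a \<Rightarrow> 'a \<Rightarrow> real) \<Rightarrow> ('a \<Rightarrow> real) \<Rightarrow> real \<Rightarrow> 'a set \<Rightarrow> ('a \<Rightarrow> real) \<Rightarrow> bool" where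
  "superharmonic_on m b c p V u \<longleftrightarrow> u \<in> F_space b p V \<and> (\<forall>x\<in>V. H_op m b c p u x \<ge> 0)"

text \<open>Positive means nonnegative and not identically zero, not strictly positive.\<close>

definition positive_on :: "'a set \<Rightarrow> ('a \<Rightarrow> real) \<Rightarrow> bool" where
  "positive_on A f \<longleftrightarrow> (\<forall>x\<in>A. f x \<ge> 0) \<and> (\<exists>x\<in>A. f x \<noteq> 0)"

definition energy ::
  "('a \<Rightarrow> 'a \<Rightarrow> real) \<Rightarrow> ('a \<Rightarrow> real) \<Rightarrow> real \<Rightarrow> ('a \<Rightarrow> real) \<Rightarrow> real" where
  "energy b c p \<phi> =
     1 / 2 * (\<Sum>\<^sub>\<infinity>(x, y). b x y * \<bar>\<phi> x - \<phi> y\<bar> powr p)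
     + (\<Sum>\<^sub>\<infinity>x. c x * \<bar>\<phi> x\<bar> powr p)"

definition energy_nonneg ::
  "('a \<Rightarrow> 'a \<Rightarrow> real) \<Rightarrow> ('a \<Rightarrow> real) \<Rightarrow> real \<Rightarrow> 'a set \<Rightarrow> bool" where
  "energy_nonneg b c p V \<longleftrightarrow> (\<forall>\<phi>\<in>Cc V. energy b c p \<phi> \<ge> 0)"

text \<open>To be used under the assumption \<open>energy_nonneg b c p V\<close>; \<open>w\<close> only matters on \<open>V\<close>.\<close>

definition subcritical ::
  "('a \<Rightarrow> 'a \<Rightarrow> real) \<Rightarrow> ('a \<Rightarrow> real) \<Rightarrow> real \<Rightarrow> 'a set \<Rightarrow> bool" where
  "subcritical b c p V \<longleftrightarrow>
     (\<exists>w. positive_on V w \<and>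
       (\<forall>\<phi>\<in>Cc V. energy b c p \<phi> \<ge> (\<Sum>\<^sub>\<infinity>x\<in>V. \<bar>\<phi> x\<bar> powr p * w x)))"

text \<open>
  The class \<open>\<M>(V - K)\<close>. It depends on the pair \<open>(V, K)\<close> and not just on the difference
  \<open>V - K\<close>; it is meant for connected \<open>V\<close> and finite \<open>K \<subseteq> V\<close>. The competitor \<open>v\<close> is positive
  on all of \<open>X\<close>.
\<close>

definition minimal_growth ::
  "('a \<Rightarrow> real) \<Rightarrow> ('a \<Rightarrow> 'a \<Rightarrow> real) \<Rightarrow> ('a \<Rightarrow> real) \<Rightarrow> real \<Rightarrow> 'a set \<Rightarrow> 'a set \<Rightarrow> ('a \<Rightarrow> real) set"
  where
  "minimal_growth m b c p V K =
     {u. harmonic_on m b c p (V - K) u \<and> positive_on (V \<union> vertex_boundary b V) u \<and>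
         (\<forall>K' v. finite K' \<and> graph_connected b K' \<and> K' \<subseteq> V \<and> K \<subseteq> K' \<and>
                 positive_on UNIV v \<and> superharmonic_on m b c p (V - K') v \<and>
                 (\<forall>x\<in>K'. u x \<le> v x)
               \<longrightarrow> (\<forall>x\<in>V - K'. u x \<le> v x))}"

definition normalised_Green ::
  "('a \<Rightarrow> real) \<Rightarrow> ('a \<Rightarrow> 'a \<Rightarrow> real) \<Rightarrow> ('a \<Rightarrow> real) \<Rightarrow> real \<Rightarrow> 'a set \<Rightarrow> 'a \<Rightarrow> ('a \<Rightarrow> real) \<Rightarrow> bool"
  where
  "normalised_Green m b c p V z u \<longleftrightarrow>
     u \<in> minimal_growth m b c p V {z} \<inter> F_space b p V \<and>
     (\<forall>x\<in>V. H_op m b c p u x = indicator {z} x)"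

end

theory Submission
  imports Defs
begin

text \<open>
  A Green's function is strictly positive and superharmonic on \<open>V\<close>, so Picone's inequality bounds
  the energy of \<open>\<phi>\<close> from below by \<open>m(z) \<bar>\<phi>(z)\<bar>\<^sup>p / G(z)\<^sup>p\<^sup>-\<^sup>1\<close>, which is subcriticality.

  Conversely, let \<open>h\<close> be subcritical and exhaust \<open>V\<close> by finite connected sets \<open>K\<^sub>n\<close> containing \<open>z\<close>.
  Since \<open>h > 0\<close> off zero, \<open>h(\<phi>) - p m(z) \<phi>(z)\<close> has a nonnegative minimiser \<open>G\<^sub>n\<close> among the functions
  supported in \<open>K\<^sub>n\<close>, and \<open>H G\<^sub>n = 1\<^sub>z\<close> on \<open>K\<^sub>n\<close>. A comparison principle makes \<open>G\<^sub>n\<close> increasing.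
  Subcriticality at one point together with Harnack's inequality bounds \<open>G\<^sub>n\<close> locally, and the limit
  solves \<open>H G = 1\<^sub>z\<close> by dominated convergence. Comparing each \<open>G\<^sub>n\<close>, which vanishes off \<open>K\<^sub>n\<close>, with a
  competitor \<open>v\<close> gives minimal growth.
\<close>

section \<open>Signed powers\<close>

lemma signed_powr_0 [simp]: "signed_powr 0 q = 0"
  by (simp add: signed_powr_def)

lemma signed_powr_nonneg: "a \<ge> 0 \<Longrightarrow> signed_powr a q = a powr q"
  by (cases "a = 0") (auto simp: signed_powr_def)

lemma signed_powr_minus: "signed_powr (- a) q = - signed_powr a q"
  by (simp add: signed_powr_def sgn_minus)

lemma abs_signed_powr: "\<bar>signed_powr a q\<bar> = \<bar>a\<bar> powr q"
  by (cases "a = 0") (auto simp: signed_powr_def abs_mult)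

lemma signed_powr_mult_self: "signed_powr a q * a = \<bar>a\<bar> powr (q + 1)"
  by (cases "a = 0") (auto simp: signed_powr_def powr_add abs_if sgn_if)

lemma signed_powr_scale: "t \<ge> 0 \<Longrightarrow> signed_powr (t * a) q = t powr q * signed_powr a q"
  by (cases "t = 0") (auto simp: signed_powr_def abs_mult powr_mult sgn_mult)

lemma strict_mono_signed_powr:
  assumes "q > 0"
  shows "strict_mono (\<lambda>a. signed_powr a q)"
proof (rule strict_monoI)
  fix a b :: real
  assume ab: "a < b"
  consider "0 \<le> a" | "a < 0" "0 \<le> b" | "b < 0" by linarith
  then show "signed_powr a q < signed_powr b q"
  proof cases
    case 1
    then show ?thesis using ab assms by (simp add: signed_powr_nonneg powr_less_mono2)
  next
    case 2
    then have "signed_powr a q < 0" by (simp add: signed_powr_def)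
    also have "0 \<le> signed_powr b q" using 2 by (simp add: signed_powr_def)
    finally show ?thesis .
  next
    case 3
    then have "(- b) powr q < (- a) powr q" using ab assms by (intro powr_less_mono2) auto
    then show ?thesis using 3 ab by (simp add: signed_powr_def)
  qed
qed

lemmas signed_powr_less_iff = strict_mono_less [OF strict_mono_signed_powr]
lemmas signed_powr_le_iff = strict_mono_less_eq [OF strict_mono_signed_powr]

text \<open>The sign jumps at 0, so a limit \<open>a = 0\<close> is handled through absolute values,
  where \<open>abs_signed_powr\<close> removes the sign.\<close>

lemma tendsto_signed_powr:
  assumes "q > 0" and "(f \<longlongrightarrow> a) F"
  shows "((\<lambda>n. signed_powr (f n) q) \<longlongrightarrow> signed_powr a q) F"
proof -
  have lim: "((\<lambda>n. \<bar>f n\<bar> powr q) \<longlongrightarrow> \<bar>a\<bar> powr q) F"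
    using assms by (intro tendsto_powr' tendsto_intros) auto
  show ?thesis
  proof (cases "a = 0")
    case True
    then show ?thesis
      using lim by (auto intro: tendsto_rabs_zero_cancel simp: abs_signed_powr)
  next
    case False
    then show ?thesis
      unfolding signed_powr_def using lim assms by (intro tendsto_mult tendsto_sgn) auto
  qed
qed

lemma DERIV_abs_powr:
  assumes "p > 1"
  shows "((\<lambda>t::real. \<bar>t\<bar> powr p) has_real_derivative p * signed_powr t (p - 1)) (at t)"
proof -
  consider "t > 0" | "t < 0" | "t = 0" by linarith
  then show ?thesis
  proof cases
    case 1
    have "((\<lambda>t. t powr p) has_real_derivative p * t powr (p - 1)) (at t)"
      using 1 by (auto intro!: derivative_eq_intros)
    then have "((\<lambda>t. \<bar>t\<bar> powr p) has_real_derivative p * t powr (p - 1)) (at t)"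
      by (rule DERIV_cong_ev [THEN iffD1, rotated -1, OF _ refl _ refl])
        (use 1 in \<open>auto intro!: eventually_mono [OF eventually_nhds_in_open [of "{0<..}"]]\<close>)
    then show ?thesis using 1 by (simp add: signed_powr_def)
  next
    case 2
    have "((\<lambda>t. (- t) powr p) has_real_derivative - p * (- t) powr (p - 1)) (at t)"
      using 2 by (auto intro!: derivative_eq_intros)
    then have "((\<lambda>t. \<bar>t\<bar> powr p) has_real_derivative - p * (- t) powr (p - 1)) (at t)"
      by (rule DERIV_cong_ev [THEN iffD1, rotated -1, OF _ refl _ refl])
        (use 2 in \<open>auto intro!: eventually_mono [OF eventually_nhds_in_open [of "{..<0}"]]\<close>)
    then show ?thesis using 2 by (simp add: signed_powr_def)
  next
    case 3
    \<comment> \<open>At the origin the difference quotient is itself a signed power with positive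
      exponent, hence tends to 0.\<close>
    have "((\<lambda>h. signed_powr h (p - 1)) \<longlongrightarrow> signed_powr 0 (p - 1)) (at 0)"
      using assms by (intro tendsto_signed_powr tendsto_ident_at) auto
    moreover have "signed_powr h (p - 1) = \<bar>h\<bar> powr p / h" if "h \<noteq> 0" for h
      using that signed_powr_mult_self [of h "p - 1"] by (simp add: field_simps)
    ultimately have "((\<lambda>h. \<bar>h\<bar> powr p / h) \<longlongrightarrow> 0) (at 0)"
      by (subst (asm) tendsto_cong [where g = "\<lambda>h. \<bar>h\<bar> powr p / h"])
        (auto simp: eventually_at_filter)
    then show ?thesis using 3 by (simp add: DERIV_def)
  qed
qed

lemma convex_on_abs_powr:
  assumes "p > 1"
  shows "convex_on UNIV (\<lambda>t::real. \<bar>t\<bar> powr p)"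
proof (rule convex_on_realI)
  fix x y :: real
  assume "x \<le> y"
  then show "p * signed_powr x (p - 1) \<le> p * signed_powr y (p - 1)"
    using assms by (simp add: signed_powr_le_iff)
qed (auto intro: DERIV_abs_powr [OF assms])

text \<open>The estimate through \<open>2 * max\<close> works for every positive exponent;
  \<open>p - 1\<close> may be below 1, where convexity of the power fails.\<close>

lemma abs_diff_powr_le:
  fixes a b q :: real
  assumes "q > 0"
  shows "\<bar>a - b\<bar> powr q \<le> 2 powr q * (\<bar>a\<bar> powr q + \<bar>b\<bar> powr q)"
proof -
  have "\<bar>a - b\<bar> powr q \<le> (2 * max \<bar>a\<bar> \<bar>b\<bar>) powr q"
    using assms by (intro powr_mono2) auto
  also have "\<dots> = 2 powr q * max \<bar>a\<bar> \<bar>b\<bar> powr q"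
    by (simp add: powr_mult)
  also have "\<dots> \<le> 2 powr q * (\<bar>a\<bar> powr q + \<bar>b\<bar> powr q)"
    by (intro mult_left_mono) (auto simp: max_def)
  finally show ?thesis .
qed

text \<open>
  Writing \<open>a = u \<alpha>\<close> and \<open>b = v \<beta>\<close> with \<open>u > v\<close>, the point \<open>\<alpha>\<close> is the convex combination of \<open>\<beta>\<close> and
  \<open>(a - b) / (u - v)\<close> with weights \<open>v / u\<close> and \<open>1 - v / u\<close>.
\<close>

lemma picone_inequality:
  assumes "p > 1" and u: "u > 0" and v: "v > 0"
  shows "signed_powr (u - v) (p - 1) * (\<bar>a\<bar> powr p / u powr (p - 1) - \<bar>b\<bar> powr p / v powr (p - 1))
    \<le> \<bar>a - b\<bar> powr p"
proof -
  have main: "signed_powr (u - v) (p - 1) * (\<bar>a\<bar> powr p / u powr (p - 1) - \<bar>b\<bar> powr p / v powr (p - 1))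
    \<le> \<bar>a - b\<bar> powr p" if uv: "u > v" and v: "v > 0" for u v a b :: real
  proof -
    have u: "u > 0" using that by simp
    define g where "g = (a - b) / (u - v)"
    \<comment> \<open>The quotient is the perspective of \<open>\<bar>t\<bar> powr p\<close>,
      homogeneous of degree 1 in \<open>(c, w)\<close>, which lets convexity act on it.\<close>
    have hom: "\<bar>c\<bar> powr p / w powr (p - 1) = w * \<bar>c / w\<bar> powr p" if "w > 0" for c w :: real
    proof -
      have "w powr p = w * w powr (p - 1)"
        using that by (simp add: powr_diff)
      then show ?thesis using that by (simp add: abs_div powr_divide)
    qed
    have comb: "a / u = (1 - v / u) * g + (v / u) * (b / v)"
    proof -
      have "(1 - v / u) * g = (a - b) / u"
        using uv u by (simp add: g_def divide_simps)
      then show ?thesis using u v by (simp add: diff_divide_distrib)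
    qed
    have "\<bar>a / u\<bar> powr p \<le> (1 - v / u) * \<bar>g\<bar> powr p + (v / u) * \<bar>b / v\<bar> powr p"
      unfolding comb
      using convex_onD [OF convex_on_abs_powr [OF \<open>p > 1\<close>], of "v / u" g "b / v"] uv u v
      by simp
    then have "u * \<bar>a / u\<bar> powr p \<le> u * ((1 - v / u) * \<bar>g\<bar> powr p + (v / u) * \<bar>b / v\<bar> powr p)"
      using u by simp
    also have "\<dots> = (u - v) * \<bar>g\<bar> powr p + v * \<bar>b / v\<bar> powr p"
      using u by (simp add: field_simps)
    finally have "u * \<bar>a / u\<bar> powr p - v * \<bar>b / v\<bar> powr p \<le> \<bar>a - b\<bar> powr p / (u - v) powr (p - 1)"
      using uv hom [of "u - v" "a - b"] by (simp add: g_def)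
    then have "(u - v) powr (p - 1) * (u * \<bar>a / u\<bar> powr p - v * \<bar>b / v\<bar> powr p)
        \<le> \<bar>a - b\<bar> powr p"
      using uv by (simp add: field_simps)
    then show ?thesis
      using uv u v by (simp add: hom signed_powr_nonneg)
  qed
  consider "u > v" | "u = v" | "v > u" by linarith
  then show ?thesis
  proof cases
    \<comment> \<open>Exchanging \<open>(u, a)\<close> with \<open>(v, b)\<close> flips the sign of
      both factors on the left, so the product is unchanged.\<close>
    case 3
    have "signed_powr (u - v) (p - 1) = - signed_powr (v - u) (p - 1)"
      using signed_powr_minus [of "v - u"] by simp
    then show ?thesis
      using main [OF 3 u, of b a] by (simp add: abs_minus_commute algebra_simps)
  qed (use main v in auto)
qed

text \<open>Real summability is absolute, so the sums are Bochner integrals over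
  \<open>count_space UNIV\<close> and dominated convergence for integrals applies.\<close>

lemma tendsto_infsum_dominated:
  fixes f :: "nat \<Rightarrow> 'b \<Rightarrow> real"
  assumes lim: "\<And>y. (\<lambda>n. f n y) \<longlonglongrightarrow> g y"
    and bound: "\<And>n y. \<bar>f n y\<bar> \<le> M y"
    and M: "M summable_on UNIV"
  shows "(\<lambda>n. infsum (f n) UNIV) \<longlonglongrightarrow> infsum g UNIV"
proof -
  have M': "integrable (count_space UNIV) M"
    using M abs_summable_equivalent [of M UNIV] summable_on_iff_abs_summable_on_real
    by (auto simp: abs_summable_on_def)
  have int: "integrable (count_space UNIV) (f n)" for n
    by (rule Bochner_Integration.integrable_bound [OF M']) (use order_trans [OF bound abs_ge_self] in auto)
  have g: "integrable (count_space UNIV) g" and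
    conv: "(\<lambda>n. integral\<^sup>L (count_space UNIV) (f n)) \<longlonglongrightarrow> integral\<^sup>L (count_space UNIV) g"
    using integrable_dominated_convergence [OF _ _ M', of g f]
      integral_dominated_convergence [OF _ _ M', of g f] lim bound by auto
  have eq: "integral\<^sup>L (count_space UNIV) h = infsum h UNIV" if "integrable (count_space UNIV) h"
    for h :: "'b \<Rightarrow> real"
    using infsetsum_infsum [of h UNIV] that by (simp add: abs_summable_on_def infsetsum_def)
  show ?thesis using conv by (simp add: eq int g)
qed

section \<open>Pointwise properties of the operator\<close>

text \<open>A property is carried along a path inside \<open>V\<close>; in this form connectedness
  enters the positivity, comparison and Harnack arguments.\<close>

lemma graph_connected_induct [consumes 3, case_names base step]:
  assumes "graph_connected b V" and "x \<in> V" and "y \<in> V" and "P x"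
    and step: "\<And>s t. s \<in> V \<Longrightarrow> t \<in> V \<Longrightarrow> adjacent b s t \<Longrightarrow> P s \<Longrightarrow> P t"
  shows "P y"
proof -
  have "(x, y) \<in> {(s, t). s \<in> V \<and> t \<in> V \<and> adjacent b s t}\<^sup>*"
    using assms by (auto simp: graph_connected_def)
  then show ?thesis
    by (induction rule: rtrancl_induct) (use \<open>P x\<close> step in auto)
qed

lemma F_space_singleton: "f \<in> F_space b p A \<Longrightarrow> x \<in> A \<Longrightarrow> f \<in> F_space b p {x}"
  by (auto simp: F_space_def)

locale p_schroedinger = connected_weighted_graph m b
  for m :: "'a \<Rightarrow> real" and b :: "'a \<Rightarrow> 'a \<Rightarrow> real" +
  fixes c :: "'a \<Rightarrow> real" and p :: real
  assumes p_gt_1: "p > 1"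
begin

abbreviation "H \<equiv> H_op m b c p"
abbreviation "F \<equiv> F_space b p"
abbreviation "E \<equiv> energy b c p"

definition deg :: "'a \<Rightarrow> real" where
  "deg x = (\<Sum>\<^sub>\<infinity>y. b x y)"

lemma deg_nonneg: "deg x \<ge> 0"
  unfolding deg_def by (intro infsum_nonneg b_nonneg)

lemma mult_H: "m x * H f x =
    (\<Sum>\<^sub>\<infinity>y. b x y * signed_powr (f x - f y) (p - 1)) + c x * signed_powr (f x) (p - 1)"
  using m_pos [of x] by (simp add: H_op_def field_simps)

lemma H_le_iff: "H f x \<le> H g x \<longleftrightarrow> m x * H f x \<le> m x * H g x"
  using m_pos [of x] by simp

text \<open>The right-hand side is summable exactly because of the \<open>F\<close> condition at
  \<open>x\<close>. It serves both for convergence of the flux sum and as the dominating function in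
  \<open>H_limit\<close>.\<close>

lemma flux_dominated:
  "\<bar>b x y * signed_powr (f x - f y) (p - 1)\<bar>
    \<le> 2 powr (p - 1) * (\<bar>f x\<bar> powr (p - 1) * b x y + b x y * \<bar>f y\<bar> powr (p - 1))"
proof -
  have "\<bar>b x y * signed_powr (f x - f y) (p - 1)\<bar> = b x y * \<bar>f x - f y\<bar> powr (p - 1)"
    by (simp add: abs_mult abs_signed_powr b_nonneg)
  also have "\<dots> \<le> b x y * (2 powr (p - 1) * (\<bar>f x\<bar> powr (p - 1) + \<bar>f y\<bar> powr (p - 1)))"
    using p_gt_1 by (intro mult_left_mono abs_diff_powr_le b_nonneg) auto
  finally show ?thesis by (simp add: algebra_simps)
qed

lemma dominating_summable:
  assumes "f \<in> F {x}"
  shows "(\<lambda>y. 2 powr (p - 1) * (a * b x y + b x y * \<bar>f y\<bar> powr (p - 1))) summable_on UNIV"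
  using assms b_summable [of x]
  by (intro summable_on_cmult_right summable_on_add) (auto simp: F_space_def)

lemma flux_summable:
  assumes "f \<in> F {x}"
  shows "(\<lambda>y. b x y * signed_powr (f x - f y) (p - 1)) summable_on UNIV"
proof -
  have "(\<lambda>y. norm (b x y * signed_powr (f x - f y) (p - 1))) summable_on UNIV"
    using flux_dominated [of x _ f]
    by (intro Infinite_Sum.abs_summable_on_comparison_test' [OF dominating_summable [OF assms]])
      (simp add: real_norm_def)
  then show ?thesis by (rule abs_summable_summable)
qed

lemma F_scale:
  assumes "f \<in> F A"
  shows "(\<lambda>x. t * f x) \<in> F A"
proof -
  have "(\<lambda>y. b x y * \<bar>t * f y\<bar> powr (p - 1)) =
      (\<lambda>y. \<bar>t\<bar> powr (p - 1) * (b x y * \<bar>f y\<bar> powr (p - 1)))" for x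
    by (auto simp: abs_mult powr_mult)
  then show ?thesis
    using assms by (simp add: F_space_def summable_on_cmult_right)
qed

lemma F_zero: "(\<lambda>_. 0) \<in> F A"
  by (simp add: F_space_def)

lemma H_zero: "H (\<lambda>_. 0) x = 0"
  by (simp add: H_op_def)

lemma H_scale:
  assumes "t \<ge> 0"
  shows "H (\<lambda>x. t * f x) x = t powr (p - 1) * H f x"
proof -
  have "signed_powr (t * f x - t * f y) (p - 1) = t powr (p - 1) * signed_powr (f x - f y) (p - 1)" for y
    using signed_powr_scale [OF assms, of "f x - f y"] by (simp add: algebra_simps)
  then have "(\<Sum>\<^sub>\<infinity>y. b x y * signed_powr (t * f x - t * f y) (p - 1)) =
      (\<Sum>\<^sub>\<infinity>y. t powr (p - 1) * (b x y * signed_powr (f x - f y) (p - 1)))"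
    by (intro infsum_cong) auto
  also have "\<dots> = t powr (p - 1) * (\<Sum>\<^sub>\<infinity>y. b x y * signed_powr (f x - f y) (p - 1))"
    by (rule infsum_cmult_right')
  finally show ?thesis
    using assms by (simp add: H_op_def signed_powr_scale algebra_simps)
qed

section \<open>Contact points, strict positivity and comparison\<close>

lemma flux_antimono:
  assumes "u x = v x" and "adjacent b x y \<Longrightarrow> u y \<le> v y"
  shows "b x y * signed_powr (v x - v y) (p - 1) \<le> b x y * signed_powr (u x - u y) (p - 1)"
proof (cases "adjacent b x y")
  case True
  then show ?thesis
    using assms p_gt_1 by (intro mult_left_mono b_nonneg) (simp add: signed_powr_le_iff)
next
  case False
  then have "b x y = 0" using b_nonneg [of x y] by (simp add: adjacent_def)
  then show ?thesis by simp
qed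

text \<open>At a contact point the potential terms agree, and raising the neighbours lowers every
  flux.\<close>

lemma H_contact_le:
  assumes "u \<in> F {x}" and "v \<in> F {x}" and "u x = v x"
    and le: "\<And>y. adjacent b x y \<Longrightarrow> u y \<le> v y"
  shows "H v x \<le> H u x"
proof -
  have "(\<Sum>\<^sub>\<infinity>y. b x y * signed_powr (v x - v y) (p - 1))
      \<le> (\<Sum>\<^sub>\<infinity>y. b x y * signed_powr (u x - u y) (p - 1))"
    using assms by (intro infsum_mono flux_summable flux_antimono)
  then show ?thesis
    using \<open>u x = v x\<close> by (simp add: H_le_iff mult_H)
qed

text \<open>A single strictly larger neighbour would make the flux sum of \<open>v\<close> strictly
  smaller, because signed powers are strictly increasing.\<close>

lemma H_contact_eq:
  assumes "u \<in> F {x}" and "v \<in> F {x}" and "u x = v x"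
    and le: "\<And>y. adjacent b x y \<Longrightarrow> u y \<le> v y"
    and "H u x \<le> H v x" and z: "adjacent b x z"
  shows "u z = v z"
proof (rule ccontr)
  assume "u z \<noteq> v z"
  with le [OF z] have "u z < v z" by simp
  have "b x z * signed_powr (v x - v z) (p - 1) < b x z * signed_powr (u x - u z) (p - 1)"
    using z \<open>u z < v z\<close> \<open>u x = v x\<close> p_gt_1
    by (auto simp: adjacent_def signed_powr_less_iff)
  then have "(\<Sum>\<^sub>\<infinity>y. b x y * signed_powr (v x - v y) (p - 1))
      < (\<Sum>\<^sub>\<infinity>y. b x y * signed_powr (u x - u y) (p - 1))"
    by (intro has_sum_strict_mono [OF has_sum_infsum [OF flux_summable]
          has_sum_infsum [OF flux_summable], where x = z] flux_antimono)
      (use assms in auto)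
  then show False
    using \<open>u x = v x\<close> \<open>H u x \<le> H v x\<close> by (simp add: H_le_iff mult_H)
qed

text \<open>Local strong minimum principle: the harmonic function 0 touches \<open>v\<close> from
  below at \<open>x\<close>.\<close>

lemma superharmonic_zero_spreads:
  assumes "v \<in> F {x}" and "H v x \<ge> 0" and "v x = 0"
    and "\<And>y. adjacent b x y \<Longrightarrow> v y \<ge> 0" and "adjacent b x z"
  shows "v z = 0"
  using H_contact_eq [of "\<lambda>_. 0" x v z] assms by (auto simp: F_zero H_zero)

lemma adjacent_in_closure: "x \<in> V \<Longrightarrow> adjacent b x y \<Longrightarrow> y \<in> V \<union> vertex_boundary b V"
  by (auto simp: vertex_boundary_def adjacent_def b_sym)

text \<open>A zero in \<open>V\<close> would spread along a path to \<open>z\<close>. Neighbours of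
  points of \<open>V\<close> may lie in the boundary, hence the sign condition there.\<close>

lemma superharmonic_strictly_positive:
  assumes V: "graph_connected b V" and v: "v \<in> F V" "\<And>x. x \<in> V \<Longrightarrow> H v x \<ge> 0"
    and nonneg: "\<And>x. x \<in> V \<union> vertex_boundary b V \<Longrightarrow> v x \<ge> 0"
    and z: "z \<in> V" "v z > 0" and x: "x \<in> V"
  shows "v x > 0"
proof (rule ccontr)
  assume "\<not> v x > 0"
  with nonneg [of x] x have "v x = 0" by auto
  have "v z = 0"
  proof (rule graph_connected_induct [OF V x z(1), where P = "\<lambda>x. v x = 0"])
    fix s t
    assume s: "s \<in> V" "adjacent b s t" "v s = 0"
    show "v t = 0"
    proof (rule superharmonic_zero_spreads [OF F_space_singleton [OF v(1) s(1)] v(2) [OF s(1)] s(3) _ s(2)])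
      show "v y \<ge> 0" if "adjacent b s y" for y
        using adjacent_in_closure [OF s(1) that] by (rule nonneg)
    qed
  qed fact
  with z show False by simp
qed

text \<open>
  If \<open>u \<le> v\<close> fails, let \<open>t > 1\<close> be the maximum of \<open>u / v\<close> on \<open>W\<close>. Where \<open>u = t v\<close>, the function
  \<open>t v\<close> touches \<open>u\<close> from above, which is only compatible with \<open>H u \<le> H v\<close> if \<open>H v\<close> vanishes and
  \<open>u = t v\<close> at all neighbours. So the contact set spreads along paths and never leaves \<open>W\<close>.
\<close>

lemma comparison_principle:
  assumes V: "graph_connected b V" and W: "finite W" "W \<subseteq> V"
    and F: "u \<in> F W" "v \<in> F W"
    and v_nonneg: "\<And>x. v x \<ge> 0" and v_pos: "\<And>x. x \<in> V \<Longrightarrow> v x > 0"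
    and Hv: "\<And>x. x \<in> W \<Longrightarrow> H v x \<ge> 0" and Huv: "\<And>x. x \<in> W \<Longrightarrow> H u x \<le> H v x"
    and outside: "\<And>x. x \<notin> W \<Longrightarrow> u x \<le> v x"
    and z: "z \<in> V" "z \<in> W \<Longrightarrow> H v z > 0"
  shows "u x \<le> v x"
proof (rule ccontr)
  assume "\<not> u x \<le> v x"
  with outside have x: "x \<in> W" and ux: "u x > v x" by force+
  define t where "t = Max ((\<lambda>y. u y / v y) ` W)"
  have "t \<in> (\<lambda>y. u y / v y) ` W"
    unfolding t_def using W x by (intro Max_in) auto
  then obtain x0 where x0: "x0 \<in> W" "t = u x0 / v x0" by auto
  have t_ge: "u y / v y \<le> t" if "y \<in> W" for y
    unfolding t_def using W that by (intro Max_ge) auto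
  have "1 < u x / v x"
    using ux v_pos [of x] x W by auto
  then have "t > 1" using t_ge [OF x] by simp
  then have tq: "t powr (p - 1) > 1" using p_gt_1 by simp
  have le: "u y \<le> t * v y" for y
  proof (cases "y \<in> W")
    case True
    then show ?thesis using t_ge [of y] v_pos [of y] W by (auto simp: field_simps)
  next
    case False
    have "1 * v y \<le> t * v y" using \<open>t > 1\<close> v_nonneg [of y] by (intro mult_right_mono) auto
    with outside [OF False] show ?thesis by simp
  qed
  have contact: "H (\<lambda>y. t * v y) s \<le> H u s" if "s \<in> W" "u s = t * v s" for s
    using that le F_space_singleton [OF F(1)] F_space_singleton [OF F(2)]
    by (intro H_contact_le F_scale) auto
  have scale: "H (\<lambda>y. t * v y) s = t powr (p - 1) * H v s" for s
    using \<open>t > 1\<close> by (simp add: H_scale)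
  have "x0 \<in> V" using x0 W by auto
  \<comment> \<open>At \<open>z\<close> the contact set must break down: \<open>z\<close> lies
    outside \<open>W\<close> or satisfies \<open>H v z > 0\<close>.\<close>
  have "z \<in> W \<and> u z = t * v z"
  proof (rule graph_connected_induct [OF V \<open>x0 \<in> V\<close> z(1), where P = "\<lambda>x. x \<in> W \<and> u x = t * v x"])
    have "v x0 \<noteq> 0" using v_pos [of x0] x0 W by auto
    then show "x0 \<in> W \<and> u x0 = t * v x0" using x0 by auto
  next
    fix s r
    assume r: "r \<in> V" "adjacent b s r" and "s \<in> W \<and> u s = t * v s"
    then have s: "s \<in> W" "u s = t * v s" by auto
    have "1 * H v s \<le> t powr (p - 1) * H v s"
      using Hv [OF s(1)] tq by (intro mult_right_mono) auto
    then have "H u s \<le> H (\<lambda>y. t * v y) s"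
      using Huv [OF s(1)] by (simp add: scale)
    then have eq: "u r = t * v r"
      by (intro H_contact_eq [of u s "\<lambda>y. t * v y" r] F_scale F_space_singleton [OF F(1) s(1)]
          F_space_singleton [OF F(2) s(1)] s r le)
    \<comment> \<open>Off \<open>W\<close>, \<open>u \<le> v\<close> together with
      \<open>u r = t * v r\<close> and \<open>t > 1\<close> would contradict
      \<open>v r > 0\<close>.\<close>
    have "r \<in> W"
    proof (rule ccontr)
      assume "r \<notin> W"
      then have "t * v r \<le> v r" using outside [of r] eq by simp
      then show False using v_pos [OF r(1)] \<open>t > 1\<close> by simp
    qed
    with eq show "r \<in> W \<and> u r = t * v r" by simp
  qed
  then have zW: "z \<in> W" and "t powr (p - 1) * H v z \<le> H u z"
    using contact scale by auto
  then have "t powr (p - 1) * H v z \<le> H v z"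
    using Huv [OF zW] by simp
  then show False using z(2) [OF zW] tq by simp
qed

section \<open>Harnack inequalities\<close>

text \<open>Large values at neighbours make the flux at \<open>x\<close> strongly negative, which
  \<open>H u x \<ge> 0\<close> tolerates only in proportion to \<open>u x powr (p - 1)\<close>. The
  factor does not depend on \<open>u\<close>.\<close>

lemma harnack_sum:
  assumes "u \<in> F {x}" and nonneg: "\<And>y. u y \<ge> 0" and "H u x \<ge> 0"
  shows "(\<Sum>\<^sub>\<infinity>y. b x y * u y powr (p - 1))
    \<le> 2 powr (p - 1) * (2 * deg x + \<bar>c x\<bar>) * u x powr (p - 1)"
proof -
  let ?S = "\<Sum>\<^sub>\<infinity>y. b x y * signed_powr (u x - u y) (p - 1)"
  \<comment> \<open>At a neighbour with \<open>u y \<le> u x\<close> the flux is at most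
    \<open>u x powr (p - 1)\<close>; the coefficient 2 keeps one copy of that power after
    subtracting it.\<close>
  have ineq: "u y powr (p - 1) \<le> 2 powr (p - 1) * (2 * u x powr (p - 1) - signed_powr (u x - u y) (p - 1))" for y
  proof (cases "u y \<le> u x")
    case True
    have "u y powr (p - 1) \<le> 1 * u x powr (p - 1)"
      using True nonneg p_gt_1 by (auto intro!: powr_mono2)
    also have "\<dots> \<le> 2 powr (p - 1) * (2 * u x powr (p - 1) - signed_powr (u x - u y) (p - 1))"
    proof (intro mult_mono)
      have "signed_powr (u x - u y) (p - 1) \<le> signed_powr (u x) (p - 1)"
        using p_gt_1 nonneg by (simp add: signed_powr_le_iff)
      then show "u x powr (p - 1) \<le> 2 * u x powr (p - 1) - signed_powr (u x - u y) (p - 1)"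
        by (simp add: signed_powr_nonneg nonneg)
    qed (use p_gt_1 in \<open>auto simp: ge_one_powr_ge_zero\<close>)
    finally show ?thesis .
  next
    case False
    have "u y powr (p - 1) = \<bar>(u y - u x) - (- u x)\<bar> powr (p - 1)"
      by (simp add: nonneg)
    also have "\<dots> \<le> 2 powr (p - 1) * (\<bar>u y - u x\<bar> powr (p - 1) + \<bar>- u x\<bar> powr (p - 1))"
      using p_gt_1 by (intro abs_diff_powr_le) auto
    also have "\<dots> = 2 powr (p - 1) * (u x powr (p - 1) - signed_powr (u x - u y) (p - 1))"
      using False by (simp add: signed_powr_def nonneg)
    also have "\<dots> \<le> 2 powr (p - 1) * (2 * u x powr (p - 1) - signed_powr (u x - u y) (p - 1))"
      by (intro mult_left_mono) auto
    finally show ?thesis .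
  qed
  have sum1: "(\<lambda>y. 2 * u x powr (p - 1) * b x y) summable_on UNIV"
    by (intro summable_on_cmult_right b_summable)
  have sum2: "(\<lambda>y. b x y * u y powr (p - 1)) summable_on UNIV"
    using assms by (simp add: F_space_def)
  note flux = flux_summable [OF assms(1)]
  have "(\<Sum>\<^sub>\<infinity>y. b x y * u y powr (p - 1)) + 2 powr (p - 1) * ?S =
      (\<Sum>\<^sub>\<infinity>y. b x y * u y powr (p - 1)
        + 2 powr (p - 1) * (b x y * signed_powr (u x - u y) (p - 1)))"
    by (simp only: infsum_add [OF sum2 summable_on_cmult_right [OF flux]] infsum_cmult_right')
  also have "\<dots> \<le> (\<Sum>\<^sub>\<infinity>y. 2 powr (p - 1) * (2 * u x powr (p - 1) * b x y))"
  proof (intro infsum_mono sum1 sum2 summable_on_cmult_right summable_on_add flux)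
    fix y
    have "b x y * u y powr (p - 1)
        \<le> b x y * (2 powr (p - 1) * (2 * u x powr (p - 1) - signed_powr (u x - u y) (p - 1)))"
      by (intro mult_left_mono ineq b_nonneg)
    then show "b x y * u y powr (p - 1) + 2 powr (p - 1) * (b x y * signed_powr (u x - u y) (p - 1))
        \<le> 2 powr (p - 1) * (2 * u x powr (p - 1) * b x y)"
      by (simp add: algebra_simps)
  qed
  also have "\<dots> = 2 powr (p - 1) * (2 * u x powr (p - 1) * deg x)"
    by (simp only: infsum_cmult_right' deg_def)
  finally have "(\<Sum>\<^sub>\<infinity>y. b x y * u y powr (p - 1))
      \<le> 2 powr (p - 1) * (2 * u x powr (p - 1) * deg x - ?S)"
    by (simp add: algebra_simps)
  also have "\<dots> \<le> 2 powr (p - 1) * (2 * u x powr (p - 1) * deg x + \<bar>c x\<bar> * u x powr (p - 1))"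
  proof (intro mult_left_mono)
    have "0 \<le> ?S + c x * signed_powr (u x) (p - 1)"
      using assms(3) m_pos [of x] by (simp flip: mult_H)
    also have "\<dots> \<le> ?S + \<bar>c x\<bar> * u x powr (p - 1)"
      by (auto simp: signed_powr_nonneg nonneg intro!: mult_right_mono)
    finally show "2 * u x powr (p - 1) * deg x - ?S
        \<le> 2 * u x powr (p - 1) * deg x + \<bar>c x\<bar> * u x powr (p - 1)"
      by simp
  qed auto
  finally show ?thesis by (simp add: algebra_simps)
qed

text \<open>Only the term of \<open>y\<close> is kept from the sum in \<open>harnack_sum\<close>,
  followed by the root of order \<open>p - 1\<close>. The constant depends on the edge
  alone.\<close>

lemma harnack_edge:
  assumes "adjacent b x y"
  obtains C where "C \<ge> 0"
    "\<And>u. u \<in> F {x} \<Longrightarrow> (\<And>z. u z \<ge> 0) \<Longrightarrow> H u x \<ge> 0 \<Longrightarrow> u y \<le> C * u x"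
proof
  define A where "A = 2 powr (p - 1) * (2 * deg x + \<bar>c x\<bar>) / b x y"
  have "b x y > 0" using assms by (simp add: adjacent_def)
  have A: "A \<ge> 0" using \<open>b x y > 0\<close> deg_nonneg [of x] by (simp add: A_def)
  show "A powr (1 / (p - 1)) \<ge> 0" by simp
  fix u assume u: "u \<in> F {x}" "\<And>z. u z \<ge> 0" "H u x \<ge> 0"
  have "b x y * u y powr (p - 1) = (\<Sum>\<^sub>\<infinity>z\<in>{y}. b x z * u z powr (p - 1))"
    by simp
  also have "\<dots> \<le> (\<Sum>\<^sub>\<infinity>z. b x z * u z powr (p - 1))"
    using u by (intro infsum_mono_neutral) (auto simp: F_space_def b_nonneg)
  also have "\<dots> \<le> 2 powr (p - 1) * (2 * deg x + \<bar>c x\<bar>) * u x powr (p - 1)"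
    using u by (intro harnack_sum)
  finally have "u y powr (p - 1) \<le> A * u x powr (p - 1)"
    using \<open>b x y > 0\<close> by (simp add: A_def field_simps)
  then have "(u y powr (p - 1)) powr (1 / (p - 1)) \<le> (A * u x powr (p - 1)) powr (1 / (p - 1))"
    using p_gt_1 by (intro powr_mono2) auto
  then show "u y \<le> A powr (1 / (p - 1)) * u x"
    using A u p_gt_1 by (simp add: powr_mult powr_powr)
qed

text \<open>Edge constants multiply along a path. Recording the finite set \<open>P\<close> of
  vertices where the supersolution property is used lets the bound apply to the Dirichlet solutions
  on all large finite sets, uniformly.\<close>

lemma harnack_chain:
  assumes "graph_connected b V" and "x \<in> V" and "y \<in> V"
  obtains P C where "finite P" "P \<subseteq> V" "C \<ge> 0"
    "\<And>u. u \<in> F P \<Longrightarrow> (\<And>z. u z \<ge> 0) \<Longrightarrow> (\<And>z. z \<in> P \<Longrightarrow> H u z \<ge> 0) \<Longrightarrow> u y \<le> C * u x"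
proof -
  from assms have "\<exists>P C. finite P \<and> P \<subseteq> V \<and> C \<ge> 0 \<and>
    (\<forall>u. u \<in> F P \<longrightarrow> (\<forall>z. u z \<ge> 0) \<longrightarrow> (\<forall>z\<in>P. H u z \<ge> 0) \<longrightarrow> u y \<le> C * u x)"
  proof (induction rule: graph_connected_induct)
    case base
    show ?case by (rule exI [of _ "{}"], rule exI [of _ 1]) simp
  next
    case (step s t)
    then obtain P C where P: "finite P" "P \<subseteq> V" "C \<ge> 0"
      "\<And>u. u \<in> F P \<Longrightarrow> (\<forall>z. u z \<ge> 0) \<Longrightarrow> (\<forall>z\<in>P. H u z \<ge> 0) \<Longrightarrow> u s \<le> C * u x"
      by blast
    obtain D where D: "D \<ge> 0"
      "\<And>u. u \<in> F {s} \<Longrightarrow> (\<And>z. u z \<ge> 0) \<Longrightarrow> H u s \<ge> 0 \<Longrightarrow> u t \<le> D * u s"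
      using harnack_edge [OF \<open>adjacent b s t\<close>] by blast
    show ?case
    proof (rule exI [of _ "insert s P"], rule exI [of _ "D * C"], intro conjI allI impI)
      fix u assume u: "u \<in> F (insert s P)" "\<forall>z. u z \<ge> 0" "\<forall>z\<in>insert s P. H u z \<ge> 0"
      have "u t \<le> D * u s" using u by (intro D) (auto simp: F_space_def)
      also have "\<dots> \<le> D * (C * u x)"
        using u by (intro mult_left_mono P D(1)) (auto simp: F_space_def)
      finally show "u t \<le> D * C * u x" by simp
    qed (use P D step in auto)
  qed
  then obtain P C where PC: "finite P" "P \<subseteq> V" "C \<ge> 0"
    "\<forall>u. u \<in> F P \<longrightarrow> (\<forall>z. u z \<ge> 0) \<longrightarrow> (\<forall>z\<in>P. H u z \<ge> 0) \<longrightarrow> u y \<le> C * u x"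
    by (elim exE conjE)
  show ?thesis
    by (rule that [OF PC(1-3)]) (rule PC(4) [rule_format])
qed

section \<open>The energy of finitely supported functions\<close>

text \<open>For functions vanishing off \<open>K\<close>, the edges leaving \<open>K\<close> act as
  an additional potential of this size.\<close>

definition outer_deg :: "'a set \<Rightarrow> 'a \<Rightarrow> real" where
  "outer_deg K x = (\<Sum>\<^sub>\<infinity>y\<in>- K. b x y)"

definition finite_energy :: "'a set \<Rightarrow> ('a \<Rightarrow> real) \<Rightarrow> real" where
  "finite_energy K \<phi> = 1 / 2 * (\<Sum>x\<in>K. \<Sum>y\<in>K. b x y * \<bar>\<phi> x - \<phi> y\<bar> powr p)
     + (\<Sum>x\<in>K. (c x + outer_deg K x) * \<bar>\<phi> x\<bar> powr p)"

lemma b_summable_on: "(\<lambda>y. b x y) summable_on A"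
  using b_summable summable_on_subset_banach by blast

text \<open>The double sum splits into four blocks. The two mixed blocks are equal by symmetry,
  which absorbs the factor 1/2, and the block off \<open>K\<close> vanishes. Afterwards the energy
  is a function of finitely many variables.\<close>

lemma energy_eq_finite_energy:
  assumes K: "finite K" and \<phi>: "\<And>x. x \<notin> K \<Longrightarrow> \<phi> x = 0"
  shows "E \<phi> = finite_energy K \<phi>"
proof -
  let ?f = "\<lambda>(x, y). b x y * \<bar>\<phi> x - \<phi> y\<bar> powr p"
  let ?S = "\<Sum>x\<in>K. outer_deg K x * \<bar>\<phi> x\<bar> powr p"
  have inner: "(?f has_sum (\<Sum>x\<in>K. \<Sum>y\<in>K. b x y * \<bar>\<phi> x - \<phi> y\<bar> powr p)) (K \<times> K)"
    using K by (intro has_sum_finiteI) (auto simp: sum.cartesian_product)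
  have out: "(?f has_sum ?S) (K \<times> (- K))"
  proof (rule has_sum_SigmaI)
    fix x assume "x \<in> K"
    have "((\<lambda>y. b x y * \<bar>\<phi> x\<bar> powr p) has_sum outer_deg K x * \<bar>\<phi> x\<bar> powr p) (- K)"
      unfolding outer_deg_def by (intro has_sum_cmult_left has_sum_infsum b_summable_on)
    then show "((\<lambda>y. ?f (x, y)) has_sum outer_deg K x * \<bar>\<phi> x\<bar> powr p) (- K)"
      by (rule has_sum_cong [THEN iffD1, rotated]) (auto simp: \<phi>)
  next
    show "((\<lambda>x. outer_deg K x * \<bar>\<phi> x\<bar> powr p) has_sum ?S) K"
      using K by simp
  next
    show "?f summable_on K \<times> (- K)"
    proof (rule summable_on_SigmaI)
      fix x assume "x \<in> K"
      have "((\<lambda>y. b x y * \<bar>\<phi> x\<bar> powr p) has_sum outer_deg K x * \<bar>\<phi> x\<bar> powr p) (- K)"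
        unfolding outer_deg_def by (intro has_sum_cmult_left has_sum_infsum b_summable_on)
      then show "((\<lambda>y. ?f (x, y)) has_sum outer_deg K x * \<bar>\<phi> x\<bar> powr p) (- K)"
        by (rule has_sum_cong [THEN iffD1, rotated]) (auto simp: \<phi>)
    qed (use K b_nonneg in auto)
  qed
  have out': "(?f has_sum ?S) ((- K) \<times> K)"
    using out by (subst has_sum_swap) (simp add: b_sym abs_minus_commute case_prod_unfold)
  have rest: "(?f has_sum 0) ((- K) \<times> (- K))"
    by (rule has_sum_0) (auto simp: \<phi>)
  have "(?f has_sum (((\<Sum>x\<in>K. \<Sum>y\<in>K. b x y * \<bar>\<phi> x - \<phi> y\<bar> powr p) + ?S) + (?S + 0)))
      ((K \<times> K \<union> K \<times> (- K)) \<union> ((- K) \<times> K \<union> (- K) \<times> (- K)))"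
    by (intro has_sum_Un_disjoint inner out out' rest) auto
  also have "(K \<times> K \<union> K \<times> (- K)) \<union> ((- K) \<times> K \<union> (- K) \<times> (- K)) = UNIV"
    by auto
  finally have double: "infsum ?f UNIV = (\<Sum>x\<in>K. \<Sum>y\<in>K. b x y * \<bar>\<phi> x - \<phi> y\<bar> powr p) + 2 * ?S"
    by (simp add: infsumI)
  have "((\<lambda>x. c x * \<bar>\<phi> x\<bar> powr p) has_sum (\<Sum>x\<in>K. c x * \<bar>\<phi> x\<bar> powr p)) UNIV"
    using K by (intro has_sum_finite_neutralI) (auto simp: \<phi>)
  then show ?thesis
    unfolding energy_def finite_energy_def double
    by (simp add: infsumI algebra_simps sum.distrib)
qed

lemma infsum_flux_split:
  assumes "f \<in> F {x}" and K: "finite K"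
  shows "(\<Sum>\<^sub>\<infinity>y. b x y * signed_powr (f x - f y) (p - 1)) =
    (\<Sum>y\<in>K. b x y * signed_powr (f x - f y) (p - 1))
    + (\<Sum>\<^sub>\<infinity>y\<in>- K. b x y * signed_powr (f x - f y) (p - 1))"
proof -
  let ?g = "\<lambda>y. b x y * signed_powr (f x - f y) (p - 1)"
  have "?g summable_on A" for A
    using flux_summable [OF assms(1)] summable_on_subset_banach by blast
  then have "infsum ?g (K \<union> - K) = infsum ?g K + infsum ?g (- K)"
    by (intro infsum_Un_disjoint) auto
  then show ?thesis using K by simp
qed

lemma F_finite_support:
  assumes "finite K" and "\<And>x. x \<notin> K \<Longrightarrow> f x = 0"
  shows "f \<in> F A"
  unfolding F_space_def
proof (intro CollectI ballI)
  fix x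
  have "((\<lambda>y. b x y * \<bar>f y\<bar> powr (p - 1)) has_sum (\<Sum>y\<in>K. b x y * \<bar>f y\<bar> powr (p - 1))) UNIV"
    using assms by (intro has_sum_finite_neutralI) auto
  then show "(\<lambda>y. b x y * \<bar>f y\<bar> powr (p - 1)) summable_on UNIV"
    by (rule has_sum_imp_summable)
qed

lemma mult_H_finite_support:
  assumes K: "finite K" and \<phi>: "\<And>x. x \<notin> K \<Longrightarrow> \<phi> x = 0"
  shows "m x * H \<phi> x = (\<Sum>y\<in>K. b x y * signed_powr (\<phi> x - \<phi> y) (p - 1))
    + (c x + outer_deg K x) * signed_powr (\<phi> x) (p - 1)"
proof -
  have "(\<Sum>\<^sub>\<infinity>y\<in>- K. b x y * signed_powr (\<phi> x - \<phi> y) (p - 1))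
      = (\<Sum>\<^sub>\<infinity>y\<in>- K. b x y * signed_powr (\<phi> x) (p - 1))"
    by (intro infsum_cong) (auto simp: \<phi>)
  also have "\<dots> = outer_deg K x * signed_powr (\<phi> x) (p - 1)"
    by (simp add: outer_deg_def infsum_cmult_left')
  finally show ?thesis
    using infsum_flux_split [of \<phi> x K, OF F_finite_support [of K \<phi>, OF K \<phi>] K]
    by (simp add: mult_H algebra_simps)
qed

section \<open>Green's formula, first variation and Picone's lower bound\<close>

text \<open>Summation by parts: the flux is antisymmetric in \<open>x\<close> and \<open>y\<close>,
  so swapping the sums shows that both halves of \<open>\<psi> x - \<psi> y\<close> contribute
  equally.\<close>

lemma finite_green_formula:
  assumes "finite K"
  shows "1 / 2 * (\<Sum>x\<in>K. \<Sum>y\<in>K. b x y * (signed_powr (\<phi> x - \<phi> y) q * (\<psi> x - \<psi> y))) =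
    (\<Sum>x\<in>K. (\<Sum>y\<in>K. b x y * signed_powr (\<phi> x - \<phi> y) q) * \<psi> x)"
proof -
  let ?S = "\<lambda>\<psi>. \<Sum>x\<in>K. \<Sum>y\<in>K. b x y * signed_powr (\<phi> x - \<phi> y) q * \<psi> x y"
  have "?S (\<lambda>x y. \<psi> y) = (\<Sum>y\<in>K. \<Sum>x\<in>K. b x y * signed_powr (\<phi> x - \<phi> y) q * \<psi> y)"
    by (rule sum.swap)
  also have "\<dots> = (\<Sum>y\<in>K. \<Sum>x\<in>K. - (b y x * signed_powr (\<phi> y - \<phi> x) q * \<psi> y))"
  proof (intro sum.cong refl)
    fix x y
    have "signed_powr (\<phi> x - \<phi> y) q = - signed_powr (\<phi> y - \<phi> x) q"
      using signed_powr_minus [of "\<phi> y - \<phi> x" q] by simp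
    then show "b x y * signed_powr (\<phi> x - \<phi> y) q * \<psi> y
        = - (b y x * signed_powr (\<phi> y - \<phi> x) q * \<psi> y)"
      by (simp add: b_sym [of x y])
  qed
  also have "\<dots> = - ?S (\<lambda>x y. \<psi> x)"
    by (simp only: sum_negf)
  finally have "?S (\<lambda>x y. \<psi> x) - ?S (\<lambda>x y. \<psi> y) = 2 * ?S (\<lambda>x y. \<psi> x)"
    by simp
  moreover have "(\<Sum>x\<in>K. \<Sum>y\<in>K. b x y * (signed_powr (\<phi> x - \<phi> y) q * (\<psi> x - \<psi> y)))
      = ?S (\<lambda>x y. \<psi> x) - ?S (\<lambda>x y. \<psi> y)"
    by (simp add: algebra_simps sum_subtractf)
  ultimately have "1 / 2 * (\<Sum>x\<in>K. \<Sum>y\<in>K. b x y * (signed_powr (\<phi> x - \<phi> y) q * (\<psi> x - \<psi> y)))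
      = ?S (\<lambda>x y. \<psi> x)"
    by linarith
  then show ?thesis by (simp only: sum_distrib_right)
qed

lemma energy_eq_sum_H:
  assumes K: "finite K" and \<phi>: "\<And>x. x \<notin> K \<Longrightarrow> \<phi> x = 0"
  shows "E \<phi> = (\<Sum>x\<in>K. m x * H \<phi> x * \<phi> x)"
proof -
  have pow: "\<bar>t\<bar> powr p = signed_powr t (p - 1) * t" for t
    by (simp add: signed_powr_mult_self)
  have "E \<phi> = finite_energy K \<phi>"
    using K \<phi> by (rule energy_eq_finite_energy)
  also have "\<dots> = (\<Sum>x\<in>K. (\<Sum>y\<in>K. b x y * signed_powr (\<phi> x - \<phi> y) (p - 1)) * \<phi> x)
      + (\<Sum>x\<in>K. (c x + outer_deg K x) * (signed_powr (\<phi> x) (p - 1) * \<phi> x))"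
    unfolding finite_energy_def pow finite_green_formula [OF K] ..
  also have "\<dots> = (\<Sum>x\<in>K. m x * H \<phi> x * \<phi> x)"
    unfolding sum.distrib [symmetric]
    by (intro sum.cong refl) (simp add: mult_H_finite_support [of K \<phi>, OF K \<phi>] distrib_right)
  finally show ?thesis .
qed

text \<open>The reverse triangle inequality on each edge; the potential term does not
  change.\<close>

lemma energy_abs_le:
  assumes K: "finite K" and \<phi>: "\<And>x. x \<notin> K \<Longrightarrow> \<phi> x = 0"
  shows "E (\<lambda>x. \<bar>\<phi> x\<bar>) \<le> E \<phi>"
proof -
  have "(\<Sum>x\<in>K. \<Sum>y\<in>K. b x y * \<bar>\<bar>\<phi> x\<bar> - \<bar>\<phi> y\<bar>\<bar> powr p) \<le> (\<Sum>x\<in>K. \<Sum>y\<in>K. b x y * \<bar>\<phi> x - \<phi> y\<bar> powr p)"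
    using p_gt_1 by (intro sum_mono mult_left_mono b_nonneg powr_mono2) auto
  moreover have "E (\<lambda>x. \<bar>\<phi> x\<bar>) = finite_energy K (\<lambda>x. \<bar>\<phi> x\<bar>)"
    using K by (rule energy_eq_finite_energy) (simp add: \<phi>)
  moreover have "E \<phi> = finite_energy K \<phi>"
    using K \<phi> by (rule energy_eq_finite_energy)
  ultimately show ?thesis
    by (simp add: finite_energy_def)
qed

lemma energy_scale: "E (\<lambda>x. t * \<phi> x) = \<bar>t\<bar> powr p * E \<phi>"
proof -
  have "\<bar>t * \<phi> x - t * \<phi> y\<bar> powr p = \<bar>t\<bar> powr p * \<bar>\<phi> x - \<phi> y\<bar> powr p" for x y
    by (simp add: abs_mult powr_mult flip: right_diff_distrib)
  then have "(\<lambda>(x, y). b x y * \<bar>t * \<phi> x - t * \<phi> y\<bar> powr p)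
      = (\<lambda>z. \<bar>t\<bar> powr p * (case z of (x, y) \<Rightarrow> b x y * \<bar>\<phi> x - \<phi> y\<bar> powr p))"
    by auto
  moreover have "(\<lambda>x. c x * \<bar>t * \<phi> x\<bar> powr p) = (\<lambda>x. \<bar>t\<bar> powr p * (c x * \<bar>\<phi> x\<bar> powr p))"
    by (auto simp: abs_mult powr_mult)
  ultimately show ?thesis
    unfolding energy_def by (simp only: infsum_cmult_right' distrib_left)
qed

text \<open>First variation of the energy: termwise differentiation of the finite form, then Green's
  formula, identifies the gradient as \<open>p * m x * H \<phi> x\<close>.\<close>

lemma energy_DERIV:
  assumes K: "finite K" and \<phi>: "\<And>x. x \<notin> K \<Longrightarrow> \<phi> x = 0" and \<psi>: "\<And>x. x \<notin> K \<Longrightarrow> \<psi> x = 0"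
  shows "((\<lambda>t. E (\<lambda>x. \<phi> x + t * \<psi> x)) has_real_derivative p * (\<Sum>x\<in>K. m x * H \<phi> x * \<psi> x)) (at 0)"
proof -
  have pow: "((\<lambda>t. \<bar>r + t * s\<bar> powr p) has_real_derivative p * signed_powr r (p - 1) * s) (at 0)" for r s
  proof -
    have "((\<lambda>t. r + t * s) has_real_derivative s) (at 0)"
      by (auto intro!: derivative_eq_intros)
    then show ?thesis
      using DERIV_chain2 [of "\<lambda>t. \<bar>t\<bar> powr p" "p * signed_powr r (p - 1)" "\<lambda>t. r + t * s" 0 s UNIV]
        DERIV_abs_powr [OF p_gt_1, of r] by simp
  qed
  have "((\<lambda>t. 1 / 2 * (\<Sum>x\<in>K. \<Sum>y\<in>K. b x y * \<bar>(\<phi> x - \<phi> y) + t * (\<psi> x - \<psi> y)\<bar> powr p)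
      + (\<Sum>x\<in>K. (c x + outer_deg K x) * \<bar>\<phi> x + t * \<psi> x\<bar> powr p)) has_real_derivative
      1 / 2 * (\<Sum>x\<in>K. \<Sum>y\<in>K. b x y * (p * signed_powr (\<phi> x - \<phi> y) (p - 1) * (\<psi> x - \<psi> y)))
      + (\<Sum>x\<in>K. (c x + outer_deg K x) * (p * signed_powr (\<phi> x) (p - 1) * \<psi> x))) (at 0)"
    by (intro DERIV_add DERIV_cmult DERIV_sum pow)
  moreover have "E (\<lambda>x. \<phi> x + t * \<psi> x) =
      1 / 2 * (\<Sum>x\<in>K. \<Sum>y\<in>K. b x y * \<bar>(\<phi> x - \<phi> y) + t * (\<psi> x - \<psi> y)\<bar> powr p)
      + (\<Sum>x\<in>K. (c x + outer_deg K x) * \<bar>\<phi> x + t * \<psi> x\<bar> powr p)" for t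
    using energy_eq_finite_energy [OF K, of "\<lambda>x. \<phi> x + t * \<psi> x"] \<phi> \<psi>
    by (simp add: finite_energy_def algebra_simps)
  moreover have "1 / 2 * (\<Sum>x\<in>K. \<Sum>y\<in>K. b x y * (p * signed_powr (\<phi> x - \<phi> y) (p - 1) * (\<psi> x - \<psi> y)))
      + (\<Sum>x\<in>K. (c x + outer_deg K x) * (p * signed_powr (\<phi> x) (p - 1) * \<psi> x))
      = p * (\<Sum>x\<in>K. m x * H \<phi> x * \<psi> x)"
  proof -
    have "1 / 2 * (\<Sum>x\<in>K. \<Sum>y\<in>K. b x y * (p * signed_powr (\<phi> x - \<phi> y) (p - 1) * (\<psi> x - \<psi> y)))
      = p * (1 / 2 * (\<Sum>x\<in>K. \<Sum>y\<in>K. b x y * (signed_powr (\<phi> x - \<phi> y) (p - 1) * (\<psi> x - \<psi> y))))"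
      by (simp add: sum_distrib_left mult.left_commute mult.assoc)
    then show ?thesis
      unfolding finite_green_formula [OF K]
      by (simp add: mult_H_finite_support [of K \<phi>, OF K \<phi>] distrib_left distrib_right sum.distrib
          sum_distrib_left mult_ac)
  qed
  ultimately show ?thesis by simp
qed

text \<open>Green's formula is applied to \<open>G\<close> with the test function
  \<open>\<bar>\<phi>\<bar> powr p / G powr (p - 1)\<close>, and Picone's inequality bounds each
  edge inside \<open>K\<close>. On edges leaving \<open>K\<close> it suffices that \<open>G\<close>
  is nonnegative at the far end.\<close>

lemma energy_ge_sum_H:
  assumes K: "finite K" and \<phi>: "\<And>x. x \<notin> K \<Longrightarrow> \<phi> x = 0"
    and G: "G \<in> F K" "\<And>x. x \<in> K \<Longrightarrow> G x > 0"
    and nonneg: "\<And>x y. x \<in> K \<Longrightarrow> adjacent b x y \<Longrightarrow> G y \<ge> 0"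
  shows "(\<Sum>x\<in>K. m x * H G x * (\<bar>\<phi> x\<bar> powr p / G x powr (p - 1))) \<le> E \<phi>"
proof -
  define \<psi> where "\<psi> x = \<bar>\<phi> x\<bar> powr p / G x powr (p - 1)" for x
  have le: "m x * H G x * \<psi> x \<le> (\<Sum>y\<in>K. b x y * signed_powr (G x - G y) (p - 1)) * \<psi> x
      + (c x + outer_deg K x) * \<bar>\<phi> x\<bar> powr p" if x: "x \<in> K" for x
  proof -
    note FG = F_space_singleton [OF G(1) x]
    have "(\<Sum>\<^sub>\<infinity>y\<in>- K. b x y * signed_powr (G x - G y) (p - 1))
        \<le> (\<Sum>\<^sub>\<infinity>y\<in>- K. b x y * signed_powr (G x) (p - 1))"
    proof (rule infsum_mono)
      show "(\<lambda>y. b x y * signed_powr (G x - G y) (p - 1)) summable_on - K"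
        using flux_summable [OF FG] summable_on_subset_banach by blast
      show "(\<lambda>y. b x y * signed_powr (G x) (p - 1)) summable_on - K"
        by (intro summable_on_cmult_left b_summable_on)
      fix y
      show "b x y * signed_powr (G x - G y) (p - 1) \<le> b x y * signed_powr (G x) (p - 1)"
        \<comment> \<open>The comparison function agrees with \<open>G\<close> at \<open>x\<close>
          and vanishes elsewhere, so it lies below \<open>G\<close> at the neighbours of
          \<open>x\<close>.\<close>
        using flux_antimono [of "\<lambda>z. if z = x then G x else 0" x G y] nonneg [OF x, of y]
        by (cases "y = x") (auto simp: b_diag)
    qed
    also have "\<dots> = outer_deg K x * signed_powr (G x) (p - 1)"
      by (simp add: outer_deg_def infsum_cmult_left')
    finally have "m x * H G x \<le> (\<Sum>y\<in>K. b x y * signed_powr (G x - G y) (p - 1))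
        + (c x + outer_deg K x) * G x powr (p - 1)"
      using infsum_flux_split [of G x K, OF FG K] G(2) [OF x]
      by (simp add: mult_H signed_powr_nonneg algebra_simps)
    then have "m x * H G x * \<psi> x \<le> ((\<Sum>y\<in>K. b x y * signed_powr (G x - G y) (p - 1))
        + (c x + outer_deg K x) * G x powr (p - 1)) * \<psi> x"
      by (rule mult_right_mono) (simp add: \<psi>_def)
    moreover have "G x powr (p - 1) * \<psi> x = \<bar>\<phi> x\<bar> powr p"
      using G(2) [OF x] by (simp add: \<psi>_def)
    ultimately show ?thesis
      by (simp only: distrib_right mult.assoc)
  qed
  have "(\<Sum>x\<in>K. m x * H G x * \<psi> x)
      \<le> (\<Sum>x\<in>K. (\<Sum>y\<in>K. b x y * signed_powr (G x - G y) (p - 1)) * \<psi> x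
        + (c x + outer_deg K x) * \<bar>\<phi> x\<bar> powr p)"
    by (intro sum_mono le)
  also have "\<dots> = 1 / 2 * (\<Sum>x\<in>K. \<Sum>y\<in>K. b x y * (signed_powr (G x - G y) (p - 1) * (\<psi> x - \<psi> y)))
      + (\<Sum>x\<in>K. (c x + outer_deg K x) * \<bar>\<phi> x\<bar> powr p)"
    by (simp only: sum.distrib finite_green_formula [OF K])
  also have "\<dots> \<le> finite_energy K \<phi>"
    unfolding finite_energy_def
  proof (intro add_right_mono mult_left_mono sum_mono b_nonneg)
    fix x y assume "x \<in> K" "y \<in> K"
    then show "signed_powr (G x - G y) (p - 1) * (\<psi> x - \<psi> y) \<le> \<bar>\<phi> x - \<phi> y\<bar> powr p"
      unfolding \<psi>_def using G(2) p_gt_1 by (intro picone_inequality) auto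
  qed auto
  finally show ?thesis
    using energy_eq_finite_energy [of K \<phi>, OF K \<phi>] by (simp add: \<psi>_def)
qed

end

section \<open>Exhaustion by finite connected sets\<close>

lemma graph_connected_Union:
  assumes "\<And>A. A \<in> \<A> \<Longrightarrow> graph_connected b A" and "\<And>A. A \<in> \<A> \<Longrightarrow> z \<in> A"
  shows "graph_connected b (\<Union>\<A>)"
  unfolding graph_connected_def
proof (intro ballI)
  let ?R = "\<lambda>A. {(s, t). s \<in> A \<and> t \<in> A \<and> adjacent b s t}"
  have path: "(s, t) \<in> (?R (\<Union>\<A>))\<^sup>*" if "A \<in> \<A>" "s \<in> A" "t \<in> A" for A s t
  proof -
    have "(s, t) \<in> (?R A)\<^sup>*"
      using assms(1) [OF that(1)] that by (auto simp: graph_connected_def)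
    moreover have "?R A \<subseteq> ?R (\<Union>\<A>)" using that by auto
    ultimately show ?thesis using rtrancl_mono by blast
  qed
  fix x y assume "x \<in> \<Union>\<A>" "y \<in> \<Union>\<A>"
  then obtain A B where "A \<in> \<A>" "x \<in> A" "B \<in> \<A>" "y \<in> B" by auto
  then show "(x, y) \<in> (?R (\<Union>\<A>))\<^sup>*"
    using path [of A x z] path [of B z y] assms(2) by (meson rtrancl_trans)
qed

context connected_weighted_graph
begin

lemma finite_connected_path:
  assumes "graph_connected b V" and "z \<in> V" and "x \<in> V"
  shows "\<exists>P. finite P \<and> P \<subseteq> V \<and> z \<in> P \<and> x \<in> P \<and> graph_connected b P"
  using assms
proof (induction rule: graph_connected_induct)
  case base
  show ?case
    using assms by (intro exI [of _ "{z}"]) (auto simp: graph_connected_def)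
next
  case (step s t)
  then obtain P where P: "finite P" "P \<subseteq> V" "z \<in> P" "s \<in> P" "graph_connected b P"
    by blast
  have "graph_connected b {s, t}"
    using \<open>adjacent b s t\<close> unfolding graph_connected_def
    by (auto intro!: r_into_rtrancl simp: adjacent_def b_sym)
  then have "graph_connected b (\<Union>{P, {s, t}})"
    using P by (intro graph_connected_Union [of _ _ s]) auto
  then show ?case
    using P step by (intro exI [of _ "\<Union>{P, {s, t}}"]) auto
qed

text \<open>Each point of an enumeration of \<open>V\<close> is joined to \<open>z\<close> by a
  finite connected set; finite unions of these stay connected because all contain
  \<open>z\<close>.\<close>

lemma finite_connected_exhaustion:
  assumes "graph_connected b V" and "z \<in> V"
  obtains K :: "nat \<Rightarrow> 'a set"
  where "\<And>n. finite (K n)" "\<And>n. graph_connected b (K n)" "\<And>n. z \<in> K n" "incseq K" "(\<Union>n. K n) = V"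
proof -
  obtain P where P: "finite (P x)" "P x \<subseteq> V" "z \<in> P x" "x \<in> P x" "graph_connected b (P x)"
    if "x \<in> V" for x
    using finite_connected_path [OF assms] by metis
  have V: "countable V" "V \<noteq> {}"
    using countable_vertices countable_subset [of V UNIV] assms by auto
  have enum: "from_nat_into V i \<in> V" for i
    using V by (intro from_nat_into)
  show thesis
  proof (rule that [of "\<lambda>n. \<Union>(P ` from_nat_into V ` {..n})"])
    fix n
    show "finite (\<Union>(P ` from_nat_into V ` {..n}))" using P(1) enum by auto
    show "graph_connected b (\<Union>(P ` from_nat_into V ` {..n}))"
      using P enum by (intro graph_connected_Union [of _ _ z]) auto
    show "z \<in> \<Union>(P ` from_nat_into V ` {..n})" using P(3) enum by auto
  next
    show "incseq (\<lambda>n. \<Union>(P ` from_nat_into V ` {..n}))"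
      by (intro incseq_SucI) (auto intro: le_SucI)
    show "(\<Union>n. \<Union>(P ` from_nat_into V ` {..n})) = V"
    proof (intro equalityI subsetI)
      fix x assume x: "x \<in> V"
      then obtain i where "x = from_nat_into V i"
        using from_nat_into_surj [OF V(1) x] by metis
      then show "x \<in> (\<Union>n. \<Union>(P ` from_nat_into V ` {..n}))"
        using P(4) [OF x] by auto
    qed (use P(2) enum in auto)
  qed
qed

end

lemma finite_subset_incseq_Union:
  fixes K :: "nat \<Rightarrow> 'a set"
  assumes "finite P" and "P \<subseteq> (\<Union>n. K n)" and "incseq K"
  shows "\<forall>\<^sub>F n in sequentially. P \<subseteq> K n"
proof -
  have "\<forall>\<^sub>F n in sequentially. \<forall>x\<in>P. x \<in> K n"
  proof (rule eventually_ball_finite [OF \<open>finite P\<close>], rule ballI)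
    fix x assume "x \<in> P"
    then obtain k where "x \<in> K k" using assms by auto
    then show "\<forall>\<^sub>F n in sequentially. x \<in> K n"
      using \<open>incseq K\<close> by (intro eventually_sequentiallyI [of k]) (auto simp: incseq_def)
  qed
  then show ?thesis by (simp add: subset_eq)
qed

context p_schroedinger
begin

section \<open>The Dirichlet problem on finite sets\<close>

text \<open>Varying a minimiser in the direction of the indicator of \<open>x\<close> isolates
  \<open>H \<phi> x\<close>. The case \<open>a > 0\<close> gives the Dirichlet Green's function, the
  case \<open>a = 0\<close> harmonicity of null functions.\<close>

lemma euler_lagrange:
  assumes K: "finite K" and \<phi>: "\<And>x. x \<notin> K \<Longrightarrow> \<phi> x = 0"
    and min: "\<And>\<psi>. (\<And>x. x \<notin> K \<Longrightarrow> \<psi> x = 0) \<Longrightarrow> E \<phi> - a * \<phi> z \<le> E \<psi> - a * \<psi> z"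
    and x: "x \<in> K"
  shows "p * (m x * H \<phi> x) = a * indicator {x} z"
proof -
  define \<psi> :: "'a \<Rightarrow> real" where "\<psi> = indicator {x}"
  have \<psi>: "\<psi> y = 0" if "y \<notin> K" for y using that x by (auto simp: \<psi>_def indicator_def)
  have "((\<lambda>t. a * (\<phi> z + t * \<psi> z)) has_real_derivative a * \<psi> z) (at 0)"
    by (auto intro!: derivative_eq_intros)
  with energy_DERIV [of K \<phi> \<psi>, OF K \<phi> \<psi>]
  have "((\<lambda>t. E (\<lambda>x. \<phi> x + t * \<psi> x) - a * (\<phi> z + t * \<psi> z)) has_real_derivative
      p * (\<Sum>y\<in>K. m y * H \<phi> y * \<psi> y) - a * \<psi> z) (at 0)"
    by (rule DERIV_diff)
  moreover have "E \<phi> - a * \<phi> z \<le> E (\<lambda>x. \<phi> x + t * \<psi> x) - a * (\<phi> z + t * \<psi> z)" for t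
    using min [of "\<lambda>x. \<phi> x + t * \<psi> x"] \<phi> \<psi> by simp
  ultimately have "p * (\<Sum>y\<in>K. m y * H \<phi> y * \<psi> y) - a * \<psi> z = 0"
    by (intro DERIV_local_min [where d = 1]) auto
  moreover have "(\<Sum>y\<in>K. m y * H \<phi> y * \<psi> y) = m x * H \<phi> x"
    using K x by (simp add: \<psi>_def indicator_def if_distrib [where f = "\<lambda>r. _ * r"] sum.delta' cong: if_cong)
  ultimately show ?thesis by (simp add: \<psi>_def)
qed

text \<open>Functions carry the product topology, so this is Tychonoff's theorem with the factors
  off \<open>K\<close> reduced to \<open>{0}\<close>.\<close>

lemma compact_box:
  assumes "R \<ge> 0"
  shows "compact {\<phi> :: 'a \<Rightarrow> real. (\<forall>x. x \<notin> K \<longrightarrow> \<phi> x = 0) \<and> (\<forall>x. \<bar>\<phi> x\<bar> \<le> R)}"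
proof -
  have "compactin (product_topology (\<lambda>i :: 'a. euclidean) UNIV)
      (PiE UNIV (\<lambda>x. if x \<in> K then {-R..R} else {0 :: real}))"
    by (subst compactin_PiE) auto
  moreover have "r \<in> (if x \<in> K then {-R..R} else {0}) \<longleftrightarrow> (x \<notin> K \<longrightarrow> r = 0) \<and> \<bar>r\<bar> \<le> R" for x r
    using assms by auto
  ultimately show ?thesis
    by (simp add: euclidean_product_topology PiE_UNIV_domain Pi_def all_conj_distrib)
qed

lemma continuous_on_energy:
  assumes "finite K" and "\<And>\<phi>. \<phi> \<in> A \<Longrightarrow> \<forall>x. x \<notin> K \<longrightarrow> \<phi> x = 0"
  shows "continuous_on A E"
proof -
  have coord: "continuous_on UNIV (\<lambda>\<phi> :: 'a \<Rightarrow> real. \<phi> x)" for x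
    by simp
  have "continuous_on UNIV (finite_energy K)"
    unfolding finite_energy_def using p_gt_1
    by (intro continuous_intros continuous_on_powr' coord) auto
  then have "continuous_on A (finite_energy K)"
    by (rule continuous_on_subset) auto
  then show ?thesis
    by (rule continuous_on_cong [THEN iffD1, rotated -1])
      (use assms in \<open>auto simp: energy_eq_finite_energy\<close>)
qed

text \<open>The constant is the minimum of the energy over the compact unit sphere of the maximum
  norm on \<open>K\<close>; homogeneity of degree \<open>p\<close> gives the rest.\<close>

lemma energy_coercive:
  assumes K: "finite K" "K \<noteq> {}"
    and pos: "\<And>\<phi> x. (\<And>x. x \<notin> K \<Longrightarrow> \<phi> x = 0) \<Longrightarrow> \<phi> x \<noteq> 0 \<Longrightarrow> E \<phi> > 0"
  obtains \<delta> where "\<delta> > 0"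
    "\<And>\<phi> r :: real. (\<And>x. x \<notin> K \<Longrightarrow> \<phi> x = 0) \<Longrightarrow> r = Max ((\<lambda>x. \<bar>\<phi> x\<bar>) ` K) \<Longrightarrow> \<delta> * r powr p \<le> E \<phi>"
proof -
  define S where "S = {\<phi> :: 'a \<Rightarrow> real. (\<forall>x. x \<notin> K \<longrightarrow> \<phi> x = 0) \<and> (\<forall>x. \<bar>\<phi> x\<bar> \<le> 1)} \<inter>
    (\<Union>x\<in>K. {\<phi>. \<bar>\<phi> x\<bar> = 1})"
  have coord: "continuous_on UNIV (\<lambda>\<phi> :: 'a \<Rightarrow> real. \<phi> x)" for x
    by simp
  have "compact S"
    unfolding S_def using K
    by (intro compact_Int_closed compact_box zero_le_one closed_UN ballI closed_Collect_eq continuous_intros coord) auto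
  moreover from K obtain y where "y \<in> K" by auto
  then have "indicator {y} \<in> S"
    by (auto simp: S_def indicator_def)
  then have "S \<noteq> {}" by auto
  moreover have "continuous_on S E"
    using K by (intro continuous_on_energy [of K]) (auto simp: S_def)
  ultimately obtain \<phi>0 where \<phi>0: "\<phi>0 \<in> S" "\<And>\<phi>. \<phi> \<in> S \<Longrightarrow> E \<phi>0 \<le> E \<phi>"
    using continuous_attains_inf [of S E] by auto
  obtain x0 where "\<bar>\<phi>0 x0\<bar> = 1"
    using \<phi>0(1) by (auto simp: S_def)
  then have "E \<phi>0 > 0"
    using \<phi>0(1) by (intro pos [of \<phi>0 x0]) (auto simp: S_def)
  then show thesis
  proof (rule that)
    fix \<phi> :: "'a \<Rightarrow> real" and r :: real
    assume \<phi>: "\<And>x. x \<notin> K \<Longrightarrow> \<phi> x = 0" and r: "r = Max ((\<lambda>x. \<bar>\<phi> x\<bar>) ` K)"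
    have r_ge: "\<bar>\<phi> x\<bar> \<le> r" if "x \<in> K" for x
      unfolding r using K that by (intro Max_ge) auto
    have "r \<in> (\<lambda>x. \<bar>\<phi> x\<bar>) ` K"
      unfolding r using K by (intro Max_in) auto
    then obtain x1 where x1: "x1 \<in> K" "r = \<bar>\<phi> x1\<bar>" by auto
    show "E \<phi>0 * r powr p \<le> E \<phi>"
    proof (cases "r = 0")
      case True
      then have "\<phi> = (\<lambda>x. 0 * \<phi> x)" using r_ge \<phi> by fastforce
      then have "E \<phi> = 0" using energy_scale [of 0 \<phi>] by simp
      with True show ?thesis by simp
    next
      case False
      with x1 have "r > 0" by simp
      have "\<bar>\<phi> x\<bar> \<le> r" for x
        using r_ge \<phi> \<open>r > 0\<close> by (cases "x \<in> K") auto
      then have "(\<lambda>x. 1 / r * \<phi> x) \<in> S"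
        using \<phi> x1 \<open>r > 0\<close> by (auto simp: S_def abs_mult field_simps)
      then have "E \<phi>0 \<le> (1 / r) powr p * E \<phi>"
        using \<phi>0(2) energy_scale [of "1 / r" \<phi>] \<open>r > 0\<close> by fastforce
      then show ?thesis
        using \<open>r > 0\<close> by (simp add: powr_divide field_simps)
    qed
  qed
qed

lemma dirichlet_green_exists:
  assumes K: "finite K" and z: "z \<in> K"
    and pos: "\<And>\<phi> x. (\<And>x. x \<notin> K \<Longrightarrow> \<phi> x = 0) \<Longrightarrow> \<phi> x \<noteq> 0 \<Longrightarrow> E \<phi> > 0"
  shows "\<exists>G. (\<forall>x. G x \<ge> 0) \<and> (\<forall>x. x \<notin> K \<longrightarrow> G x = 0) \<and> (\<forall>x\<in>K. H G x = indicator {z} x)"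
proof -
  \<comment> \<open>With this factor the Euler-Lagrange equation at \<open>z\<close> reads
    \<open>H G z = 1\<close>.\<close>
  define a where "a = p * m z"
  have "a > 0" using p_gt_1 m_pos by (simp add: a_def)
  obtain \<delta> where \<delta>: "\<delta> > 0"
    "\<And>\<phi> r :: real. (\<And>x. x \<notin> K \<Longrightarrow> \<phi> x = 0) \<Longrightarrow> r = Max ((\<lambda>x. \<bar>\<phi> x\<bar>) ` K) \<Longrightarrow> \<delta> * r powr p \<le> E \<phi>"
    using energy_coercive [of K] K z pos by blast
  \<comment> \<open>Chosen so that \<open>\<delta> * r powr p \<ge> a * r\<close> for
    \<open>r \<ge> R\<close>. Outside the box the functional is then nonnegative, hence no better
    than at 0, and a minimiser on the box is global.\<close>
  define R where "R = (a / \<delta>) powr (1 / (p - 1))"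
  have R: "\<delta> * R powr (p - 1) = a" "R \<ge> 0"
    using \<delta>(1) \<open>a > 0\<close> p_gt_1 by (simp_all add: R_def powr_powr)
  define B where "B = {\<phi> :: 'a \<Rightarrow> real. (\<forall>x. x \<notin> K \<longrightarrow> \<phi> x = 0) \<and> (\<forall>x. \<bar>\<phi> x\<bar> \<le> R)}"
  have "compact B" unfolding B_def using R(2) by (rule compact_box)
  moreover have zero: "(\<lambda>_. 0) \<in> B" using R by (simp add: B_def)
  moreover have "continuous_on B (\<lambda>\<phi>. E \<phi> - a * \<phi> z)"
  proof -
    have "continuous_on B (\<lambda>\<phi> :: 'a \<Rightarrow> real. \<phi> z)"
      by (rule continuous_on_subset [OF continuous_on_product_coordinates]) auto
    moreover have "continuous_on B E"
      using K by (intro continuous_on_energy [of K]) (auto simp: B_def)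
    ultimately show ?thesis by (intro continuous_intros)
  qed
  ultimately obtain \<phi> where \<phi>: "\<phi> \<in> B" "\<And>\<psi>. \<psi> \<in> B \<Longrightarrow> E \<phi> - a * \<phi> z \<le> E \<psi> - a * \<psi> z"
    using continuous_attains_inf [of B "\<lambda>\<phi>. E \<phi> - a * \<phi> z"] by auto
  have \<phi>_supp: "\<phi> x = 0" if "x \<notin> K" for x using that \<phi>(1) by (auto simp: B_def)
  have E0: "E (\<lambda>_. 0) = 0" using energy_scale [of 0 "\<lambda>_. 0"] by simp
  have global: "E \<phi> - a * \<phi> z \<le> E \<psi> - a * \<psi> z" if \<psi>: "\<And>x. x \<notin> K \<Longrightarrow> \<psi> x = 0" for \<psi>
  proof (cases "\<psi> \<in> B")
    case True
    then show ?thesis by (rule \<phi>(2))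
  next
    case False
    define r where "r = Max ((\<lambda>x. \<bar>\<psi> x\<bar>) ` K)"
    have r_ge: "\<bar>\<psi> x\<bar> \<le> r" if "x \<in> K" for x
      unfolding r_def using K that by (intro Max_ge) auto
    obtain x where x: "\<not> \<bar>\<psi> x\<bar> \<le> R"
      using False \<psi> by (auto simp: B_def)
    have "x \<in> K"
    proof (rule ccontr)
      assume "x \<notin> K"
      then show False using \<psi> [of x] x R(2) by simp
    qed
    with x r_ge [of x] R have "r > R" "r > 0" by auto
    have "a \<le> \<delta> * r powr (p - 1)"
      unfolding R(1) [symmetric] using \<open>r > R\<close> R(2) \<delta>(1) p_gt_1
      by (intro mult_left_mono powr_mono2) auto
    then have "a * r \<le> \<delta> * r powr (p - 1) * r"
      using \<open>r > 0\<close> by (intro mult_right_mono) auto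
    also have "\<dots> = \<delta> * r powr p"
      using \<open>r > 0\<close> by (simp add: powr_diff)
    also have "\<dots> \<le> E \<psi>"
      using \<psi> r_def by (rule \<delta>(2))
    finally have "a * r \<le> E \<psi>" .
    moreover have "a * \<psi> z \<le> a * r"
      using r_ge [OF z] \<open>a > 0\<close> by (intro mult_left_mono) auto
    moreover have "E \<phi> - a * \<phi> z \<le> 0"
      using \<phi>(2) [OF zero] E0 by simp
    ultimately show ?thesis by linarith
  qed
  \<comment> \<open>Passing to absolute values does not increase the functional, so \<open>G\<close>
    is again a minimiser.\<close>
  define G where "G = (\<lambda>x. \<bar>\<phi> x\<bar>)"
  have G_supp: "G x = 0" if "x \<notin> K" for x using \<phi>_supp that by (simp add: G_def)
  have "H G x = indicator {z} x" if "x \<in> K" for x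
  proof -
    have "p * (m x * H G x) = a * indicator {x} z"
    proof (rule euler_lagrange [OF K])
      fix \<psi> :: "'a \<Rightarrow> real" assume "\<And>x. x \<notin> K \<Longrightarrow> \<psi> x = 0"
      then have "E \<phi> - a * \<phi> z \<le> E \<psi> - a * \<psi> z" by (rule global)
      moreover have "E G \<le> E \<phi>"
        unfolding G_def using K \<phi>_supp by (rule energy_abs_le)
      moreover have "a * \<phi> z \<le> a * G z"
        using \<open>a > 0\<close> by (simp add: G_def)
      ultimately show "E G - a * G z \<le> E \<psi> - a * \<psi> z" by linarith
    qed (use G_supp that in auto)
    then show ?thesis
      using p_gt_1 m_pos [of x] m_pos [of z] by (auto simp: a_def indicator_def split: if_splits)
  qed
  then show ?thesis
    using G_supp by (intro exI [of _ G]) (auto simp: G_def)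
qed

section \<open>Positivity of the energy and of supersolutions\<close>

text \<open>If \<open>u z = 0\<close>, then 0 touches \<open>u\<close> from below at
  \<open>z\<close>, which forces \<open>H u z \<le> 0\<close>.\<close>

lemma nonneg_positive_source:
  assumes "u \<in> F {z}" and "\<And>y. adjacent b z y \<Longrightarrow> u y \<ge> 0" and "u z \<ge> 0" and "H u z > 0"
  shows "u z > 0"
proof (rule ccontr)
  assume "\<not> u z > 0"
  then have "H u z \<le> H (\<lambda>_. 0) z"
    using assms by (intro H_contact_le F_zero) auto
  then show False using assms(4) by (simp add: H_zero)
qed

text \<open>The weight is reduced to one vertex where it is positive, which is all that the
  positivity of the energy and the bound on the approximations require.\<close>

lemma subcritical_energy_ge:
  assumes "subcritical b c p V"
  obtains y w where "y \<in> V" "w > 0" "\<And>\<phi>. \<phi> \<in> Cc V \<Longrightarrow> w * \<bar>\<phi> y\<bar> powr p \<le> E \<phi>"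
proof -
  obtain w where w: "positive_on V w"
    "\<And>\<phi>. \<phi> \<in> Cc V \<Longrightarrow> (\<Sum>\<^sub>\<infinity>x\<in>V. \<bar>\<phi> x\<bar> powr p * w x) \<le> E \<phi>"
    using assms by (auto simp: subcritical_def)
  then obtain y where y: "y \<in> V" "w y > 0"
    unfolding positive_on_def by force
  show thesis
  proof (rule that [OF y])
    fix \<phi> assume \<phi>: "\<phi> \<in> Cc V"
    have "((\<lambda>x. \<bar>\<phi> x\<bar> powr p * w x) has_sum (\<Sum>x\<in>{x. \<phi> x \<noteq> 0}. \<bar>\<phi> x\<bar> powr p * w x)) V"
      using \<phi> by (intro has_sum_finite_neutralI) (auto simp: Cc_def)
    then have summable: "(\<lambda>x. \<bar>\<phi> x\<bar> powr p * w x) summable_on V"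
      by (rule has_sum_imp_summable)
    have "w y * \<bar>\<phi> y\<bar> powr p = (\<Sum>\<^sub>\<infinity>x\<in>{y}. \<bar>\<phi> x\<bar> powr p * w x)"
      by simp
    also have "\<dots> \<le> (\<Sum>\<^sub>\<infinity>x\<in>V. \<bar>\<phi> x\<bar> powr p * w x)"
      using y w(1) by (intro infsum_mono_neutral summable) (auto simp: positive_on_def)
    also have "\<dots> \<le> E \<phi>" by (rule w(2) [OF \<phi>])
    finally show "w y * \<bar>\<phi> y\<bar> powr p \<le> E \<phi>" .
  qed
qed

text \<open>A nonzero null function \<open>\<phi>\<close> would minimise the energy, so \<open>\<bar>\<phi>\<bar>\<close> would be harmonic on \<open>V\<close> and
  hence strictly positive there.\<close>

lemma subcritical_energy_pos:
  assumes V: "graph_connected b V" and nonneg: "energy_nonneg b c p V"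
    and sub: "subcritical b c p V" and \<phi>: "\<phi> \<in> Cc V" "\<phi> x0 \<noteq> 0"
  shows "E \<phi> > 0"
proof (rule ccontr)
  assume "\<not> E \<phi> > 0"
  define \<psi> where "\<psi> = (\<lambda>x. \<bar>\<phi> x\<bar>)"
  have supp: "finite {x. \<phi> x \<noteq> 0}" "{x. \<phi> x \<noteq> 0} \<subseteq> V" using \<phi> by (auto simp: Cc_def)
  have \<psi>: "\<psi> \<in> Cc V" using \<phi> by (auto simp: Cc_def \<psi>_def)
  have "E \<psi> \<le> E \<phi>"
    unfolding \<psi>_def using supp(1) by (rule energy_abs_le) auto
  with \<open>\<not> E \<phi> > 0\<close> have "E \<psi> \<le> 0" by simp
  have harm: "H \<psi> x = 0" if "x \<in> V" for x
  proof -
    \<comment> \<open>The support is enlarged by \<open>x\<close>, so that variations at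
      \<open>x\<close> are admissible even where \<open>\<phi>\<close> vanishes.\<close>
    let ?K = "insert x {x. \<phi> x \<noteq> 0}"
    have "p * (m x * H \<psi> x) = 0 * indicator {x} x"
    proof (rule euler_lagrange [of ?K])
      fix \<eta> :: "'a \<Rightarrow> real" assume \<eta>: "\<And>y. y \<notin> ?K \<Longrightarrow> \<eta> y = 0"
      then have "{y. \<eta> y \<noteq> 0} \<subseteq> ?K" by auto
      then have "\<eta> \<in> Cc V"
        using supp that finite_subset [of _ ?K] by (auto simp: Cc_def)
      then have "E \<eta> \<ge> 0" using nonneg by (simp add: energy_nonneg_def)
      then show "E \<psi> - 0 * \<psi> x \<le> E \<eta> - 0 * \<eta> x" using \<open>E \<psi> \<le> 0\<close> by simp
    qed (use supp in \<open>auto simp: \<psi>_def\<close>)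
    then show ?thesis using p_gt_1 m_pos [of x] by simp
  qed
  have "\<psi> \<in> F V"
    using supp(1) by (rule F_finite_support) (simp add: \<psi>_def)
  have pos: "\<psi> x > 0" if "x \<in> V" for x
  proof (rule superharmonic_strictly_positive [OF V \<open>\<psi> \<in> F V\<close> _ _ _ _ that])
    show "x0 \<in> V" "\<psi> x0 > 0" using supp(2) \<phi>(2) by (auto simp: \<psi>_def)
    show "\<psi> y \<ge> 0" for y by (simp add: \<psi>_def)
  qed (simp add: harm)
  obtain y w where y: "y \<in> V" "w > 0" "\<And>\<phi>. \<phi> \<in> Cc V \<Longrightarrow> w * \<bar>\<phi> y\<bar> powr p \<le> E \<phi>"
    using subcritical_energy_ge [OF sub] by blast
  \<comment> \<open>Strict positivity reaches the vertex \<open>y\<close> carrying the weight, so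
    the energy of \<open>\<psi>\<close> cannot be nonpositive.\<close>
  have "w * \<bar>\<psi> y\<bar> powr p > 0" using y(2) pos [OF y(1)] by simp
  with y(3) [OF \<psi>] \<open>E \<psi> \<le> 0\<close> show False by simp
qed

section \<open>Monotone limits\<close>

text \<open>A Fatou argument: \<open>harnack_sum\<close> bounds every finite partial sum by a
  multiple of \<open>g x powr (p - 1)\<close> uniformly in \<open>n\<close>, and the bound survives
  the limit.\<close>

lemma F_limit:
  assumes "\<And>y. (\<lambda>n. f n y) \<longlonglongrightarrow> g y" and nonneg: "\<And>n y. f n y \<ge> 0" and le: "\<And>n y. f n y \<le> g y"
    and F: "\<And>n. f n \<in> F {x}" and ev: "\<forall>\<^sub>F n in sequentially. H (f n) x \<ge> 0"
  shows "g \<in> F {x}"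
proof -
  let ?A = "2 powr (p - 1) * (2 * deg x + \<bar>c x\<bar>)"
  have g: "g y \<ge> 0" for y using nonneg [of 0 y] le [of 0 y] by simp
  have "(\<Sum>y\<in>Y. b x y * \<bar>g y\<bar> powr (p - 1)) \<le> ?A * g x powr (p - 1)" if Y: "finite Y" for Y
  proof (rule tendsto_upperbound)
    show "(\<lambda>n. \<Sum>y\<in>Y. b x y * \<bar>f n y\<bar> powr (p - 1)) \<longlonglongrightarrow> (\<Sum>y\<in>Y. b x y * \<bar>g y\<bar> powr (p - 1))"
      using p_gt_1 assms(1) by (intro tendsto_intros tendsto_powr') auto
    show "\<forall>\<^sub>F n in sequentially. (\<Sum>y\<in>Y. b x y * \<bar>f n y\<bar> powr (p - 1)) \<le> ?A * g x powr (p - 1)"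
      using ev
    proof eventually_elim
      case (elim n)
      have "(\<Sum>y\<in>Y. b x y * \<bar>f n y\<bar> powr (p - 1)) = (\<Sum>\<^sub>\<infinity>y\<in>Y. b x y * f n y powr (p - 1))"
        using Y nonneg by simp
      also have "\<dots> \<le> (\<Sum>\<^sub>\<infinity>y. b x y * f n y powr (p - 1))"
        using F [of n] Y nonneg by (intro infsum_mono_neutral) (auto simp: F_space_def b_nonneg)
      also have "\<dots> \<le> ?A * f n x powr (p - 1)"
        using F nonneg elim by (rule harnack_sum)
      also have "\<dots> \<le> ?A * g x powr (p - 1)"
        using p_gt_1 nonneg le deg_nonneg [of x] by (intro mult_left_mono powr_mono2) auto
      finally show ?case .
    qed
  qed auto
  then have "(\<lambda>y. b x y * \<bar>g y\<bar> powr (p - 1)) summable_on UNIV"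
    by (intro nonneg_bdd_above_summable_on bdd_aboveI [where M = "?A * g x powr (p - 1)"])
      (auto simp: b_nonneg)
  then show ?thesis by (simp add: F_space_def)
qed

lemma H_limit:
  assumes lim: "\<And>y. (\<lambda>n. f n y) \<longlonglongrightarrow> g y" and le: "\<And>n y. \<bar>f n y\<bar> \<le> \<bar>g y\<bar>"
    and g: "g \<in> F {x}"
  shows "(\<lambda>n. H (f n) x) \<longlonglongrightarrow> H g x"
proof -
  have "(\<lambda>n. \<Sum>\<^sub>\<infinity>y. b x y * signed_powr (f n x - f n y) (p - 1))
      \<longlonglongrightarrow> (\<Sum>\<^sub>\<infinity>y. b x y * signed_powr (g x - g y) (p - 1))"
  proof (rule tendsto_infsum_dominated [OF _ _ dominating_summable [OF g]])
    show "(\<lambda>n. b x y * signed_powr (f n x - f n y) (p - 1)) \<longlonglongrightarrow> b x y * signed_powr (g x - g y) (p - 1)" for y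
      using p_gt_1 by (intro tendsto_intros tendsto_signed_powr lim) auto
    fix n y
    have "\<bar>b x y * signed_powr (f n x - f n y) (p - 1)\<bar>
        \<le> 2 powr (p - 1) * (\<bar>f n x\<bar> powr (p - 1) * b x y + b x y * \<bar>f n y\<bar> powr (p - 1))"
      by (rule flux_dominated)
    also have "\<dots> \<le> 2 powr (p - 1) * (\<bar>g x\<bar> powr (p - 1) * b x y + b x y * \<bar>g y\<bar> powr (p - 1))"
      using p_gt_1 le by (intro mult_left_mono mult_right_mono add_mono powr_mono2 b_nonneg) auto
    finally show "\<bar>b x y * signed_powr (f n x - f n y) (p - 1)\<bar>
        \<le> 2 powr (p - 1) * (\<bar>g x\<bar> powr (p - 1) * b x y + b x y * \<bar>g y\<bar> powr (p - 1))" .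
  qed
  then show ?thesis
    unfolding H_op_def using p_gt_1 by (intro tendsto_intros tendsto_signed_powr lim) auto
qed

section \<open>Green's functions\<close>

lemma green_approximation:
  assumes V: "graph_connected b V" and nonneg: "energy_nonneg b c p V"
    and sub: "subcritical b c p V" and z: "z \<in> V"
  obtains K :: "nat \<Rightarrow> 'a set" and G g
  where "\<And>n. finite (K n)" "\<And>n. K n \<subseteq> V" "incseq K" "(\<Union>n. K n) = V"
    "\<And>n x. G n x \<ge> 0" "\<And>n x. x \<notin> K n \<Longrightarrow> G n x = 0" "\<And>n. G n \<in> F UNIV"
    "\<And>n x. x \<in> K n \<Longrightarrow> H (G n) x = indicator {z} x"
    "\<And>x. (\<lambda>n. G n x) \<longlonglongrightarrow> g x" "\<And>n x. G n x \<le> g x"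
proof -
  obtain K :: "nat \<Rightarrow> 'a set" where K: "\<And>n. finite (K n)" "\<And>n. graph_connected b (K n)"
    "\<And>n. z \<in> K n" "incseq K" "(\<Union>n. K n) = V"
    using finite_connected_exhaustion [OF V z] by blast
  have KV: "K n \<subseteq> V" for n using K(5) by auto
  have "\<exists>G. (\<forall>x. G x \<ge> 0) \<and> (\<forall>x. x \<notin> K n \<longrightarrow> G x = 0) \<and> (\<forall>x\<in>K n. H G x = indicator {z} x)" for n
  proof (rule dirichlet_green_exists [OF K(1) K(3)])
    fix \<phi> :: "'a \<Rightarrow> real" and x
    assume \<phi>: "\<And>x. x \<notin> K n \<Longrightarrow> \<phi> x = 0" "\<phi> x \<noteq> 0"
    then have "{x. \<phi> x \<noteq> 0} \<subseteq> K n" by auto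
    then have "\<phi> \<in> Cc V"
      using KV [of n] finite_subset [OF _ K(1) [of n]] by (auto simp: Cc_def)
    then show "E \<phi> > 0" using \<phi>(2) by (rule subcritical_energy_pos [OF V nonneg sub])
  qed
  then obtain G where G: "\<And>n x. G n x \<ge> 0" "\<And>n x. x \<notin> K n \<Longrightarrow> G n x = 0"
    "\<And>n x. x \<in> K n \<Longrightarrow> H (G n) x = indicator {z} x"
    by metis
  have GF: "G n \<in> F A" for n A
    using K(1) G(2) by (rule F_finite_support)
  have HG_nonneg: "H (G n) x \<ge> 0" if "x \<in> K n" for n x
    using G(3) [OF that] by simp
  have Gz: "G n z > 0" for n
    using G(1,3) K(3) by (simp add: nonneg_positive_source [OF GF])
  have pos: "G n x > 0" if "x \<in> K n" for n x
    by (rule superharmonic_strictly_positive [OF K(2) GF HG_nonneg G(1) K(3) Gz that])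
  have mono: "incseq (\<lambda>n. G n y)" for y
  proof (rule incseq_SucI)
    fix n
    have sub: "K n \<subseteq> K (Suc n)" using K(4) by (simp add: incseq_Suc_iff)
    \<comment> \<open>Comparison takes place on \<open>K n\<close>, off which \<open>G n\<close>
      vanishes, inside the connected set \<open>K (Suc n)\<close>, where \<open>G (Suc n)\<close> is
      strictly positive; the source at \<open>z\<close> makes it strict.\<close>
    show "G n y \<le> G (Suc n) y"
    proof (rule comparison_principle [OF K(2) K(1) sub GF GF])
      show "H (G n) x \<le> H (G (Suc n)) x" if "x \<in> K n" for x
        using G(3) that sub by auto
      show "H (G (Suc n)) x \<ge> 0" if "x \<in> K n" for x
        using that sub by (intro HG_nonneg) auto
      show "z \<in> K n \<Longrightarrow> H (G (Suc n)) z > 0" using G(3) K(3) by simp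
      show "G n x \<le> G (Suc n) x" if "x \<notin> K n" for x using G that by simp
    qed (use G(1) pos K(3) in auto)
  qed
  \<comment> \<open>The constant is independent of \<open>n\<close>; the inequality holds as soon as
    the path from \<open>harnack_chain\<close> lies in \<open>K n\<close>.\<close>
  have harnack: "\<exists>C\<ge>0. \<forall>\<^sub>F n in sequentially. G n y \<le> C * G n x" if x: "x \<in> V" and y: "y \<in> V" for x y
  proof -
    obtain P C where P: "finite P" "P \<subseteq> V" "C \<ge> 0"
      "\<And>u. u \<in> F P \<Longrightarrow> (\<And>z. u z \<ge> 0) \<Longrightarrow> (\<And>z. z \<in> P \<Longrightarrow> H u z \<ge> 0) \<Longrightarrow> u y \<le> C * u x"
      using harnack_chain [OF V x y] by metis
    have "\<forall>\<^sub>F n in sequentially. P \<subseteq> K n"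
      using P K by (intro finite_subset_incseq_Union) auto
    then have "\<forall>\<^sub>F n in sequentially. G n y \<le> C * G n x"
      by eventually_elim (intro P(4) GF G(1) HG_nonneg, auto)
    then show ?thesis using P(3) by blast
  qed
  \<comment> \<open>The weight may sit at a vertex other than the pole \<open>z\<close>; Harnack's
    inequality transfers the estimate between them.\<close>
  obtain x0 w where x0: "x0 \<in> V" "w > 0" "\<And>\<phi>. \<phi> \<in> Cc V \<Longrightarrow> w * \<bar>\<phi> x0\<bar> powr p \<le> E \<phi>"
    using subcritical_energy_ge [OF sub] by blast
  obtain C where C: "C \<ge> 0" "\<forall>\<^sub>F n in sequentially. G n z \<le> C * G n x0"
    using harnack [OF x0(1) z] by blast
  define B where "B = (m z * C / w) powr (1 / (p - 1))"
  \<comment> \<open>\<open>w G\<^sub>n(x0)\<^sup>p \<le> E G\<^sub>n = m(z) G\<^sub>n(z)\<close>, and the right-hand side is at most linear in \<open>G\<^sub>n(x0)\<close>.\<close>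
  have bound: "\<forall>\<^sub>F n in sequentially. G n x0 \<le> B"
    using C(2)
  proof eventually_elim
    case (elim n)
    show ?case
    proof (cases "G n x0 = 0")
      case True
      then show ?thesis by (simp add: B_def)
    next
      case False
      with G(1) [of n x0] have g: "G n x0 > 0" by simp
      have "{x. G n x \<noteq> 0} \<subseteq> K n" using G(2) by auto
      then have "G n \<in> Cc V"
        using KV [of n] finite_subset [OF _ K(1) [of n]] by (auto simp: Cc_def)
      then have "w * G n x0 powr p \<le> E (G n)" using x0(3) [of "G n"] G(1) by simp
      also have "\<dots> = (\<Sum>x\<in>K n. m x * H (G n) x * G n x)"
        using K(1) G(2) by (rule energy_eq_sum_H)
      also have "\<dots> = (\<Sum>x\<in>K n. if x = z then m z * G n z else 0)"
        by (intro sum.cong) (auto simp: G(3))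
      also have "\<dots> = m z * G n z"
        using K(1,3) by (simp add: sum.delta)
      also have "\<dots> \<le> m z * (C * G n x0)"
        using elim m_pos [of z] by simp
      finally have "G n x0 powr (p - 1) \<le> m z * C / w"
        using g x0(2) by (simp add: powr_diff field_simps)
      then have "(G n x0 powr (p - 1)) powr (1 / (p - 1)) \<le> B"
        unfolding B_def using p_gt_1 by (intro powr_mono2) auto
      then show ?thesis using g p_gt_1 by (simp add: powr_powr)
    qed
  qed
  have "\<exists>M. \<forall>n. G n y \<le> M" for y
  proof (cases "y \<in> V")
    case True
    obtain D where D: "D \<ge> 0" "\<forall>\<^sub>F n in sequentially. G n y \<le> D * G n x0"
      using harnack [OF x0(1) True] by blast
    from D(2) bound have "\<forall>\<^sub>F n in sequentially. G n y \<le> D * B"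
    proof eventually_elim
      case (elim n)
      then show ?case using mult_left_mono [OF elim(2) D(1)] by linarith
    qed
    then obtain N where N: "\<And>n. n \<ge> N \<Longrightarrow> G n y \<le> D * B"
      by (auto simp: eventually_sequentially)
    \<comment> \<open>Monotonicity in \<open>n\<close> carries the eventual bound back to the small
      indices.\<close>
    have "G n y \<le> D * B" for n
      using N [of "max n N"] incseqD [OF mono, of n "max n N" y] by simp
    then show ?thesis by blast
  next
    case False
    then have "G n y = 0" for n using G(2) KV by auto
    then show ?thesis by auto
  qed
  then have "\<exists>l. (\<lambda>n. G n y) \<longlonglongrightarrow> l \<and> (\<forall>n. G n y \<le> l)" for y
    using incseq_convergent [OF mono, of y] by metis
  then obtain g where "\<And>y. (\<lambda>n. G n y) \<longlonglongrightarrow> g y" "\<And>n y. G n y \<le> g y"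
    by metis
  then show thesis
    using that [of K G g] K KV G GF by blast
qed

lemma green_exists:
  assumes V: "graph_connected b V" and nonneg: "energy_nonneg b c p V"
    and sub: "subcritical b c p V" and z: "z \<in> V"
  shows "\<exists>g. normalised_Green m b c p V z g"
proof -
  obtain K :: "nat \<Rightarrow> 'a set" and G g
    where K: "\<And>n. finite (K n)" "\<And>n. K n \<subseteq> V" "incseq K" "(\<Union>n. K n) = V"
      and G: "\<And>n x. G n x \<ge> 0" "\<And>n x. x \<notin> K n \<Longrightarrow> G n x = 0" "\<And>n. G n \<in> F UNIV"
        "\<And>n x. x \<in> K n \<Longrightarrow> H (G n) x = indicator {z} x"
      and g: "\<And>x. (\<lambda>n. G n x) \<longlonglongrightarrow> g x" "\<And>n x. G n x \<le> g x"
    using green_approximation [OF assms] by metis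
  have GF: "G n \<in> F A" for n A using G(3) by (auto simp: F_space_def)
  have g_nonneg: "g x \<ge> 0" for x using G(1) [of 0 x] g(2) [of 0 x] by simp
  have ev: "\<forall>\<^sub>F n in sequentially. H (G n) x = indicator {z} x" if "x \<in> V" for x
  proof -
    have "\<forall>\<^sub>F n in sequentially. {x} \<subseteq> K n"
      using K that by (intro finite_subset_incseq_Union) auto
    then show ?thesis by eventually_elim (auto intro: G(4))
  qed
  have gF': "g \<in> F {x}" if "x \<in> V" for x
  proof (rule F_limit [OF g(1) G(1) g(2) GF])
    show "\<forall>\<^sub>F n in sequentially. H (G n) x \<ge> 0"
      using ev [OF that] by eventually_elim simp
  qed
  then have gF: "g \<in> F A" if "A \<subseteq> V" for A using that by (auto simp: F_space_def)
  have Hg: "H g x = indicator {z} x" if "x \<in> V" for x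
  proof (rule LIMSEQ_unique)
    show "(\<lambda>n. H (G n) x) \<longlonglongrightarrow> H g x"
      using G(1) g g_nonneg by (intro H_limit gF' [OF that]) auto
    show "(\<lambda>n. H (G n) x) \<longlonglongrightarrow> indicator {z} x"
      by (intro tendsto_eventually ev that)
  qed
  have gz: "g z > 0"
    by (rule nonneg_positive_source [OF gF' [OF z]]) (simp_all add: g_nonneg Hg [OF z])
  have g_pos: "g x > 0" if "x \<in> V" for x
    by (rule superharmonic_strictly_positive [OF V gF [OF subset_refl] _ g_nonneg z gz that]) (simp add: Hg)
  have minimal: "g x \<le> v x"
    if K': "finite K'" "K' \<subseteq> V" "z \<in> K'" and v: "positive_on UNIV v" "superharmonic_on m b c p (V - K') v"
      and le: "\<And>x. x \<in> K' \<Longrightarrow> g x \<le> v x" for K' v x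
  proof -
    have v_nonneg: "v y \<ge> 0" for y using v(1) by (auto simp: positive_on_def)
    have vF: "v \<in> F (V - K')" and Hv: "\<And>y. y \<in> V - K' \<Longrightarrow> H v y \<ge> 0"
      using v(2) by (auto simp: superharmonic_on_def)
    \<comment> \<open>A zero of \<open>v\<close> lies outside \<open>K'\<close>, since
      \<open>v \<ge> g > 0\<close> on \<open>K'\<close>. There \<open>v\<close> is superharmonic, so
      the zero spreads without entering \<open>K'\<close>, yet would have to reach \<open>z\<close>,
      which lies in \<open>K'\<close>.\<close>
    have "v y \<noteq> 0" if y: "y \<in> V" for y
    proof
      assume "v y = 0"
      have "v z = 0 \<and> z \<notin> K'"
      proof (rule graph_connected_induct [OF V y z, where P = "\<lambda>y. v y = 0 \<and> y \<notin> K'"])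
        show "v y = 0 \<and> y \<notin> K'"
          using \<open>v y = 0\<close> le [of y] g_pos [OF y] by auto
      next
        fix s t
        assume st: "s \<in> V" "t \<in> V" "adjacent b s t" "v s = 0 \<and> s \<notin> K'"
        then have s: "s \<in> V - K'" by simp
        have "v t = 0"
          using superharmonic_zero_spreads [OF F_space_singleton [OF vF s] Hv [OF s] _ v_nonneg st(3)] st(4)
          by simp
        then show "v t = 0 \<and> t \<notin> K'" using le [of t] g_pos [OF st(2)] by auto
      qed
      with K'(3) show False by simp
    qed
    then have v_pos: "v y > 0" if "y \<in> V" for y using v_nonneg [of y] that by force
    \<comment> \<open>Off \<open>K n - K'\<close> either \<open>G n \<le> g \<le> v\<close> on
      \<open>K'\<close>, or \<open>G n\<close> vanishes. The pole lies in \<open>K'\<close>, so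
      contact cannot spread to it.\<close>
    have "G n x \<le> v x" for n
    proof (rule comparison_principle [OF V, of "K n - K'" "G n" v z])
      show "v \<in> F (K n - K')" using vF K(2) by (auto simp: F_space_def)
      show "H (G n) y \<le> H v y" if "y \<in> K n - K'" for y
      proof -
        have y: "y \<in> V - K'" "y \<noteq> z" "y \<in> K n" using that K(2) K'(3) by auto
        then show ?thesis using Hv [OF y(1)] by (simp add: G(4))
      qed
      show "H v y \<ge> 0" if "y \<in> K n - K'" for y using that K(2) by (intro Hv) auto
      show "G n y \<le> v y" if "y \<notin> K n - K'" for y
      proof (cases "y \<in> K'")
        case True
        then show ?thesis using le [of y] g(2) [of n y] by simp
      next
        case False
        then show ?thesis using that G(2) v_nonneg by auto
      qed
    qed (use K GF v_nonneg v_pos z K'(3) in auto)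
    then show ?thesis by (intro LIMSEQ_le_const2 [OF g(1)]) auto
  qed
  have "g \<in> minimal_growth m b c p V {z}"
    unfolding minimal_growth_def
  proof (intro CollectI conjI allI impI ballI)
    show "harmonic_on m b c p (V - {z}) g"
      unfolding harmonic_on_def using gF Hg by auto
    show "positive_on (V \<union> vertex_boundary b V) g"
      using g_nonneg gz z by (force simp: positive_on_def)
  qed (use minimal in auto)
  then show ?thesis
    using gF Hg by (auto simp: normalised_Green_def)
qed

lemma green_imp_subcritical:
  assumes V: "graph_connected b V" and z: "z \<in> V" and green: "normalised_Green m b c p V z g"
  shows "subcritical b c p V"
proof -
  have gF: "g \<in> F V" and Hg: "\<And>x. x \<in> V \<Longrightarrow> H g x = indicator {z} x"
    and g_nonneg: "\<And>x. x \<in> V \<union> vertex_boundary b V \<Longrightarrow> g x \<ge> 0"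
    using green by (auto simp: normalised_Green_def minimal_growth_def positive_on_def)
  have adj: "g y \<ge> 0" if "x \<in> V" "adjacent b x y" for x y
    by (rule g_nonneg [OF adjacent_in_closure [OF that]])
  have gz: "g z > 0"
    by (rule nonneg_positive_source [OF F_space_singleton [OF gF z] adj [OF z]])
      (simp_all add: g_nonneg z Hg)
  have g_pos: "g x > 0" if "x \<in> V" for x
    by (rule superharmonic_strictly_positive [OF V gF _ g_nonneg z gz that]) (simp_all add: Hg)
  \<comment> \<open>As \<open>H g\<close> is concentrated at \<open>z\<close>, the lower bound in
    \<open>energy_ge_sum_H\<close> has a single surviving term, with this coefficient.\<close>
  define w where "w = (\<lambda>x. indicator {z} x * (m z / g z powr (p - 1)))"
  have wz: "w z > 0" using gz m_pos by (simp add: w_def)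
  have "(\<Sum>\<^sub>\<infinity>x\<in>V. \<bar>\<phi> x\<bar> powr p * w x) \<le> E \<phi>" if \<phi>: "\<phi> \<in> Cc V" for \<phi>
  proof -
    let ?K = "insert z {x. \<phi> x \<noteq> 0}"
    have K: "finite ?K" "?K \<subseteq> V" using \<phi> z by (auto simp: Cc_def)
    have "((\<lambda>x. \<bar>\<phi> x\<bar> powr p * w x) has_sum \<bar>\<phi> z\<bar> powr p * w z) V"
      using z by (intro has_sum_finite_neutralI [where B = "{z}"]) (auto simp: w_def)
    then have "(\<Sum>\<^sub>\<infinity>x\<in>V. \<bar>\<phi> x\<bar> powr p * w x) = \<bar>\<phi> z\<bar> powr p * w z"
      by (rule infsumI)
    also have "\<dots> = (\<Sum>x\<in>?K. if x = z then \<bar>\<phi> z\<bar> powr p * w z else 0)"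
      using K(1) by (subst sum.delta) auto
    also have "\<dots> = (\<Sum>x\<in>?K. m x * H g x * (\<bar>\<phi> x\<bar> powr p / g x powr (p - 1)))"
    proof (intro sum.cong refl)
      fix x assume "x \<in> ?K"
      then have "x \<in> V" using K(2) by auto
      then show "(if x = z then \<bar>\<phi> z\<bar> powr p * w z else 0)
          = m x * H g x * (\<bar>\<phi> x\<bar> powr p / g x powr (p - 1))"
        by (simp add: Hg w_def)
    qed
    also have "\<dots> \<le> E \<phi>"
    proof (rule energy_ge_sum_H [OF K(1)])
      show "g \<in> F ?K" using gF K(2) by (auto simp: F_space_def)
      show "g x > 0" if "x \<in> ?K" for x using that K(2) by (intro g_pos) auto
      show "g y \<ge> 0" if "x \<in> ?K" "adjacent b x y" for x y
        using that K(2) by (intro adj) auto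
    qed auto
    finally show ?thesis .
  qed
  moreover have "positive_on V w"
    unfolding positive_on_def
  proof
    show "\<forall>x\<in>V. w x \<ge> 0" using m_pos [of z] by (simp add: w_def)
    show "\<exists>x\<in>V. w x \<noteq> 0" using z wz by force
  qed
  ultimately show ?thesis unfolding subcritical_def by blast
qed

end

theorem theorem2p5:
  fixes m c :: "'a \<Rightarrow> real" and b :: "'a \<Rightarrow> 'a \<Rightarrow> real" and p :: real and V :: "'a set"
  assumes "connected_weighted_graph m b"
    and "p > 1"
    and "V \<noteq> {}"
    and "graph_connected b V"
    and "energy_nonneg b c p V"
  shows "subcritical b c p V \<longleftrightarrow> (\<forall>z\<in>V. \<exists>G. normalised_Green m b c p V z G)"
proof -
  interpret p_schroedinger m b c p
    using assms by (intro p_schroedinger.intro p_schroedinger_axioms.intro)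
  \<comment> \<open>For the converse one pole suffices, and \<open>V \<noteq> {}\<close> supplies
    it.\<close>
  show ?thesis
    using green_exists green_imp_subcritical assms(3-5) by blast
qed

end
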